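(* For every integer $k\ge 2$ there exists a constant $c_k$ such that for all sufficiently large $n$ (depending on $k$), \[ \frac{c_k n^k}{k!\,(k+1)!}\le \log_2|\mathcal{B}(n,k)|\le \frac{n^k}{k!\,\log 2}, \] and, furthermore, the constants $c_k$ can be taken to satisfy $\displaystyle\lim_{k\to\infty}\frac{c_k}{k!/\sqrt{24\pi k}}=1$. (That is, there is a sequence $(c_k)_{k\ge2}$ with this limit such that for each $k\ge2$ the two inequalities hold for all sufficiently large $n$.)
   Context: $\log$ is the natural logarithm. Let $\binom{[n]}{k}$ be the set of $k$-element subsets of $[n]=\{1,\dots,n\}$, each written in increasing order. For $X=[x_1<\dots<x_m]$ its packet is $P(X)=\{X\setminus\{x_i\}:1\le i\le m\}$. The lex order is the lexicographic order of increasing sequences and antilex is its reverse. A total order $\rho$ on $\binom{[n]}{k}$ is admissible if for every $X\in\binom{[n]}{k+1}$ the restriction $\rho|_{P(X)}$ is the lex or the antilex order on $P(X)$. $X,Y\in\binom{[n]}{k}$ commute if $P(X)\cap P(Y)=\varnothing$. Two admissible orders (written as sequences) are commutation equivalent if one is obtained from the other by a sequence of transpositions of adjacent commuting elements. The higher Bruhat order $\mathcal{B}(n,k)$ has as its underlying set the set of commutation equivalence classes of admissible orders on $\binom{[n]}{k}$. *)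

theory Defs
  imports Complex_Main "HOL-Library.Ramsey" "HOL-Combinatorics.Multiset_Permutations"
begin

definition packet :: "nat set \<Rightarrow> nat set set" where
  "packet X = {X - {x} |x. x \<in> X}"

text \<open>Lexicographic order of finite sets, compared as increasing sequences.\<close>

definition lex_less :: "nat set \<Rightarrow> nat set \<Rightarrow> bool" where
  "lex_less X Y \<longleftrightarrow>
     (sorted_list_of_set X, sorted_list_of_set Y) \<in> lexord {(a, b). a < b}"

text \<open>
  A total order on the \<open>k\<close>-subsets of \<open>{1..n}\<close> is represented by the list that enumerates them
  from smallest to largest without repetition; its restriction to a packet is the sublist
  of the members of the packet.
\<close>

definition admissible_orders :: "nat \<Rightarrow> nat \<Rightarrow> nat set list set" where
  "admissible_orders n k =
     {\<rho> \<in> permutations_of_set (nsets {1..n} k).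
        \<forall>X \<in> nsets {1..n} (k + 1).
          sorted_wrt lex_less (filter (\<lambda>Y. Y \<in> packet X) \<rho>) \<or>
          sorted_wrt (\<lambda>A B. lex_less B A) (filter (\<lambda>Y. Y \<in> packet X) \<rho>)}"

definition commuting :: "nat set \<Rightarrow> nat set \<Rightarrow> bool" where
  "commuting X Y \<longleftrightarrow> packet X \<inter> packet Y = {}"

inductive commuting_swap :: "nat set list \<Rightarrow> nat set list \<Rightarrow> bool" where
  "commuting X Y \<Longrightarrow> commuting_swap (us @ X # Y # vs) (us @ Y # X # vs)"

text \<open>
  The intermediate sequences are not required to be admissible. This makes no difference:
  two \<open>k\<close>-subsets lying in a common packet \<open>packet X\<close> never commute when \<open>k \<ge> 1\<close>, so a swap
  leaves all restrictions to packets unchanged.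
\<close>

definition commutation_equiv :: "nat \<Rightarrow> nat \<Rightarrow> (nat set list \<times> nat set list) set" where
  "commutation_equiv n k =
     {(\<rho>, \<sigma>). \<rho> \<in> admissible_orders n k \<and> \<sigma> \<in> admissible_orders n k \<and>
              commuting_swap\<^sup>*\<^sup>* \<rho> \<sigma>}"

definition higher_bruhat :: "nat \<Rightarrow> nat \<Rightarrow> nat set list set set" where
  "higher_bruhat n k = admissible_orders n k // commutation_equiv n k"

lemma finite_admissible_orders: "finite (admissible_orders n k)"
  unfolding admissible_orders_def
  by (rule finite_subset[of _ "permutations_of_set (nsets {1..n} k)"]) auto

lemma commuting_swap_sym: "commuting_swap \<rho> \<sigma> \<Longrightarrow> commuting_swap \<sigma> \<rho>"
  by (auto simp: commuting_def elim!: commuting_swap.cases intro!: commuting_swap.intros)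

lemma equiv_commutation_equiv: "equiv (admissible_orders n k) (commutation_equiv n k)"
proof (rule equivI)
  have "symp commuting_swap"
    by (blast intro: sympI commuting_swap_sym)
  then have "symp commuting_swap\<^sup>*\<^sup>*"
    by (rule symp_rtranclp)
  then show "sym (commutation_equiv n k)"
    by (auto simp: commutation_equiv_def sym_def dest: sympD)
  show "trans (commutation_equiv n k)"
    by (auto simp: commutation_equiv_def trans_def)
  show "refl_on (admissible_orders n k) (commutation_equiv n k)"
    by (auto simp: commutation_equiv_def refl_on_def)
  show "commutation_equiv n k \<subseteq> admissible_orders n k \<times> admissible_orders n k"
    by (auto simp: commutation_equiv_def)
qed

lemma finite_higher_bruhat: "finite (higher_bruhat n k)"
  unfolding higher_bruhat_def
  by (rule finite_quotient)
    (auto simp: finite_admissible_orders commutation_equiv_def)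

end

theory Submission
  imports Defs
begin

text \<open>
  A class in \<open>\<B>(n, k)\<close> is determined by the set of \<open>(k + 1)\<close>-sets whose packet is ordered
  antilexicographically.

  Upper bound. Deletion and contraction of \<open>n + 1\<close> determine the class, so
  \<open>|\<B>(n + 1, k + 1)| \<le> |\<B>(n, k + 1)| |\<B>(n, k)|\<close>, and by Pascal's rule \<open>|\<B>(n, k)| \<le> exp (n choose k)\<close>
  follows from the case \<open>k = 2\<close>. There a class is encoded, as in Felsner's encoding of pseudoline
  arrangements, by recording for every \<open>i\<close> which positions in the sequence of the pairs \<open>{i, j}\<close>
  are taken by some \<open>j < i\<close>; this leaves \<open>\<Prod>\<^sub>i (n - 1 choose i - 1) \<le> exp (n choose 2)\<close> possibilities.

  Lower bound. Fix \<open>s\<close>. The packets of the \<open>(k + 1)\<close>-sets with element sum \<open>s\<close> are pairwise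
  disjoint, and each of them can be ordered lexicographically or antilexicographically at will, while the
  packet of \<open>X\<close> is antilex if \<open>\<Sum>X < s\<close> and lex if \<open>\<Sum>X > s\<close>. By Chebyshev's inequality some
  \<open>s\<close> is the sum of at least \<open>n\<^sup>k / ((k + 1)! sqrt (24 \<pi> k))\<close> sets, so \<open>c\<^sub>k = k! / sqrt (24 \<pi> k)\<close> works
  without any error term.
\<close>

section \<open>Inversion sets\<close>

primrec precedes :: "'a list \<Rightarrow> 'a \<Rightarrow> 'a \<Rightarrow> bool" where
  "precedes [] A B \<longleftrightarrow> False"
| "precedes (x # xs) A B \<longleftrightarrow> x = A \<and> B \<in> set xs \<or> precedes xs A B"

lemma precedes_in_set: "precedes xs A B \<Longrightarrow> A \<in> set xs \<and> B \<in> set xs"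
  by (induction xs) auto

lemma precedes_append:
  "precedes (xs @ ys) A B \<longleftrightarrow> precedes xs A B \<or> precedes ys A B \<or> A \<in> set xs \<and> B \<in> set ys"
  by (induction xs) auto

lemma sorted_wrt_iff_precedes: "sorted_wrt R xs \<longleftrightarrow> (\<forall>A B. precedes xs A B \<longrightarrow> R A B)"
  by (induction xs) auto

lemma precedes_filter: "precedes (filter P xs) A B \<longleftrightarrow> precedes xs A B \<and> P A \<and> P B"
  by (induction xs) (auto dest: precedes_in_set)

lemma precedes_map:
  assumes "inj_on f (set xs)" "A \<in> set xs" "B \<in> set xs"
  shows "precedes (map f xs) (f A) (f B) \<longleftrightarrow> precedes xs A B"
proof -
  have "precedes (map f ys) (f A) (f B) \<longleftrightarrow> precedes ys A B" if "set ys \<subseteq> set xs" for ys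
    using that
  proof (induction ys)
    case (Cons y ys)
    then have "f y = f A \<longleftrightarrow> y = A" "f B \<in> f ` set ys \<longleftrightarrow> B \<in> set ys"
      using assms by (auto simp: inj_on_eq_iff inj_on_image_mem_iff[OF assms(1)])
    then show ?case
      using Cons by simp
  qed simp
  then show ?thesis by simp
qed

lemma precedes_asym: "distinct xs \<Longrightarrow> precedes xs A B \<Longrightarrow> \<not> precedes xs B A"
  by (induction xs) (auto dest: precedes_in_set)

lemma precedes_trans: "distinct xs \<Longrightarrow> precedes xs A B \<Longrightarrow> precedes xs B C \<Longrightarrow> precedes xs A C"
  by (induction xs) (auto dest: precedes_in_set)

lemma precedes_total: "A \<in> set xs \<Longrightarrow> B \<in> set xs \<Longrightarrow> A \<noteq> B \<Longrightarrow> precedes xs A B \<or> precedes xs B A"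
  by (induction xs) auto

section \<open>Lex and antilex packets, indexed by removed elements\<close>

lemma lexord_remove1:
  fixes a b :: nat
  assumes "sorted_wrt (<) l" "a \<in> set l" "b \<in> set l" "a < b"
  shows "(remove1 b l, remove1 a l) \<in> lexord {(x, y). x < y}"
  using assms
proof (induction l)
  case (Cons h t)
  show ?case
  proof (cases "h = a")
    case True
    \<comment> \<open>Since \<open>b\<close> follows \<open>a\<close>, the tail is nonempty. Its
      head exceeds \<open>a\<close> and becomes the first entry once \<open>a\<close> is removed, so
      the two lists differ at once.\<close>
    with Cons.prems obtain h' t' where "t = h' # t'" "a < h'" by (cases t) auto
    with True Cons.prems show ?thesis by auto
  next
    case False
    with Cons show ?thesis by auto
  qed
qed simp

lemma lex_less_remove:
  assumes "finite X" "a \<in> X" "b \<in> X" "a < b"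
  shows "lex_less (X - {b}) (X - {a})"
  using assms lexord_remove1[of "sorted_list_of_set X" a b]
  by (simp add: lex_less_def sorted_list_of_set_remove)

lemma lex_less_asym: "lex_less X Y \<Longrightarrow> \<not> lex_less Y X"
  unfolding lex_less_def by (rule lexord_asymmetric) (auto intro!: asymI)

lemma lex_less_remove_iff:
  assumes "finite X" "a \<in> X" "b \<in> X"
  shows "lex_less (X - {b}) (X - {a}) \<longleftrightarrow> a < b"
proof (cases a b rule: linorder_cases)
  case equal
  then show ?thesis using lex_less_asym by auto
qed (use assms lex_less_remove lex_less_asym in \<open>auto dest: less_imp_not_less\<close>)

text \<open>Members of a packet are addressed by the element removed. Removing the larger element
  leaves the lex smaller set, hence \<open>X - {b}\<close> comes first.\<close>

definition lex_on_packet :: "nat set list \<Rightarrow> nat set \<Rightarrow> bool" where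
  "lex_on_packet \<rho> X \<longleftrightarrow> (\<forall>a\<in>X. \<forall>b\<in>X. a < b \<longrightarrow> precedes \<rho> (X - {b}) (X - {a}))"

definition antilex_on_packet :: "nat set list \<Rightarrow> nat set \<Rightarrow> bool" where
  "antilex_on_packet \<rho> X \<longleftrightarrow> (\<forall>a\<in>X. \<forall>b\<in>X. a < b \<longrightarrow> precedes \<rho> (X - {a}) (X - {b}))"

text \<open>The inversion set in the sense of Manin and Schechtman.\<close>

definition inversions :: "nat \<Rightarrow> nat \<Rightarrow> nat set list \<Rightarrow> nat set set" where
  "inversions n k \<rho> = {X \<in> nsets {1..n} (k + 1). antilex_on_packet \<rho> X}"

text \<open>Bridge from the filtered sublists in \<open>admissible_orders_def\<close>. A sorted
  sublist excludes the wrong comparison and totality of \<open>\<rho>\<close> on the packet supplies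
  the right one; the converse uses asymmetry.\<close>

lemma sorted_on_packet_iff:
  assumes "distinct \<rho>" "finite X" "packet X \<subseteq> set \<rho>"
  shows "sorted_wrt lex_less (filter (\<lambda>Y. Y \<in> packet X) \<rho>) \<longleftrightarrow> lex_on_packet \<rho> X" (is ?lex)
    and "sorted_wrt (\<lambda>A B. lex_less B A) (filter (\<lambda>Y. Y \<in> packet X) \<rho>) \<longleftrightarrow> antilex_on_packet \<rho> X"
      (is ?antilex)
proof -
  have mem: "X - {a} \<in> packet X" "X - {a} \<in> set \<rho>" if "a \<in> X" for a
    using that assms(3) by (auto simp: packet_def)
  have neq: "X - {a} \<noteq> X - {b}" if "a \<in> X" "b \<in> X" "a < b" for a b
    using that by auto
  have irrefl: "\<not> precedes \<rho> A A" for A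
    using precedes_asym[OF assms(1)] by metis
  show ?lex
  proof
    assume L: "sorted_wrt lex_less (filter (\<lambda>Y. Y \<in> packet X) \<rho>)"
    show "lex_on_packet \<rho> X"
      unfolding lex_on_packet_def
    proof (intro ballI impI)
      fix a b assume ab: "a \<in> X" "b \<in> X" "a < b"
      then have "\<not> precedes \<rho> (X - {a}) (X - {b})"
        using L mem(1)[of a] mem(1)[of b] lex_less_remove_iff[OF assms(2), of b a]
        by (auto simp: sorted_wrt_iff_precedes precedes_filter)
      then show "precedes \<rho> (X - {b}) (X - {a})"
        using precedes_total mem neq ab by metis
    qed
  next
    assume R: "lex_on_packet \<rho> X"
    have "lex_less (X - {b}) (X - {a})"
      if "precedes \<rho> (X - {b}) (X - {a})" "a \<in> X" "b \<in> X" for a b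
      using that R lex_less_remove_iff[OF assms(2)] precedes_asym[OF assms(1)] irrefl
      unfolding lex_on_packet_def by (metis linorder_cases)
    then show "sorted_wrt lex_less (filter (\<lambda>Y. Y \<in> packet X) \<rho>)"
      by (auto simp: sorted_wrt_iff_precedes precedes_filter packet_def)
  qed
  show ?antilex
  proof
    assume L: "sorted_wrt (\<lambda>A B. lex_less B A) (filter (\<lambda>Y. Y \<in> packet X) \<rho>)"
    show "antilex_on_packet \<rho> X"
      unfolding antilex_on_packet_def
    proof (intro ballI impI)
      fix a b assume ab: "a \<in> X" "b \<in> X" "a < b"
      then have "\<not> precedes \<rho> (X - {b}) (X - {a})"
        using L mem(1)[of a] mem(1)[of b] lex_less_remove_iff[OF assms(2), of b a]
        by (auto simp: sorted_wrt_iff_precedes precedes_filter)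
      then show "precedes \<rho> (X - {a}) (X - {b})"
        using precedes_total mem neq ab by metis
    qed
  next
    assume R: "antilex_on_packet \<rho> X"
    have "lex_less (X - {b}) (X - {a})"
      if "precedes \<rho> (X - {a}) (X - {b})" "a \<in> X" "b \<in> X" for a b
      using that R lex_less_remove_iff[OF assms(2)] precedes_asym[OF assms(1)] irrefl
      unfolding antilex_on_packet_def by (metis linorder_cases)
    then show "sorted_wrt (\<lambda>A B. lex_less B A) (filter (\<lambda>Y. Y \<in> packet X) \<rho>)"
      by (auto simp: sorted_wrt_iff_precedes precedes_filter packet_def)
  qed
qed

lemma packet_subset_nsets:
  assumes "X \<in> nsets V (k + 1)"
  shows "packet X \<subseteq> nsets V k"
  using assms by (auto simp: nsets_def packet_def)

lemma remove_in_nsets: "X \<in> nsets V (k + 1) \<Longrightarrow> a \<in> X \<Longrightarrow> X - {a} \<in> nsets V k"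
  by (auto simp: nsets_def)

lemma admissible_orders_iff:
  "\<rho> \<in> admissible_orders n k \<longleftrightarrow> distinct \<rho> \<and> set \<rho> = nsets {1..n} k \<and>
     (\<forall>X \<in> nsets {1..n} (k + 1). lex_on_packet \<rho> X \<or> antilex_on_packet \<rho> X)"
proof -
  have "sorted_wrt lex_less (filter (\<lambda>Y. Y \<in> packet X) \<rho>) \<or>
          sorted_wrt (\<lambda>A B. lex_less B A) (filter (\<lambda>Y. Y \<in> packet X) \<rho>) \<longleftrightarrow>
        lex_on_packet \<rho> X \<or> antilex_on_packet \<rho> X"
    if "distinct \<rho>" "set \<rho> = nsets {1..n} k" "X \<in> nsets {1..n} (k + 1)" for X
    using that sorted_on_packet_iff[of \<rho> X] packet_subset_nsets[of X "{1..n}" k]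
    by (auto simp: nsets_def)
  then show ?thesis
    unfolding admissible_orders_def permutations_of_set_def by blast
qed

lemma nsets_two_elements:
  assumes "X \<in> nsets V (k + 1)" "k \<ge> 1"
  obtains a b :: nat where "a \<in> X" "b \<in> X" "a < b"
proof -
  have "2 \<le> card X" using assms by (auto simp: nsets_def)
  moreover have "finite X" using assms by (simp add: nsets_def)
  ultimately obtain a b where "a \<in> X" "b \<in> X" "a \<noteq> b"
    using card_le_Suc0_iff_eq[of X] by auto
  then show ?thesis using that by (metis linorder_neqE_nat)
qed

text \<open>In an admissible order a packet that is not antilex is lex, so a single pair of members
  decides between the two.\<close>

lemma inversions_iff:
  assumes "\<rho> \<in> admissible_orders n k" "X \<in> nsets {1..n} (k + 1)" "a \<in> X" "b \<in> X" "a < b"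
  shows "X \<in> inversions n k \<rho> \<longleftrightarrow> precedes \<rho> (X - {a}) (X - {b})"
  using assms precedes_asym[of \<rho>]
  unfolding admissible_orders_iff inversions_def lex_on_packet_def antilex_on_packet_def by blast

section \<open>Commutation classes correspond to inversion sets\<close>

lemma not_commuting_packet:
  assumes "A \<in> packet X" "B \<in> packet X" "A \<noteq> B"
  shows "\<not> commuting A B"
proof -
  from assms obtain a b where "a \<in> X" "b \<in> X" "A = X - {a}" "B = X - {b}" "a \<noteq> b"
    by (auto simp: packet_def)
  then have "X - {a, b} \<in> packet A" "X - {a, b} \<in> packet B"
    unfolding packet_def by blast+
  then show ?thesis by (auto simp: commuting_def)
qed

text \<open>Distinct sets that do not commute arise from a common subset by adding one element each.
  Their union therefore has just one element more than \<open>A\<close> and serves as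
  \<open>X\<close>.\<close>

lemma not_commuting_nsets:
  assumes "\<not> commuting A B" "A \<in> nsets V k" "B \<in> nsets V k" "A \<noteq> B"
  obtains X a b where "X \<in> nsets V (k + 1)" "a \<in> X" "b \<in> X" "a \<noteq> b" "A = X - {a}" "B = X - {b}"
proof -
  from assms(1) obtain C where "C \<in> packet A" "C \<in> packet B" by (auto simp: commuting_def)
  then obtain a b where C: "b \<in> A" "a \<in> B" "C = A - {b}" "C = B - {a}"
    by (auto simp: packet_def)
  then have "a \<noteq> b" "a \<notin> A" "b \<notin> B" using assms(4) by blast+
  show ?thesis
  proof (rule that[of "insert a A" a b])
    show "insert a A \<in> nsets V (k + 1)"
      using assms(2,3) C \<open>a \<notin> A\<close> by (auto simp: nsets_def)
    show "B = insert a A - {b}" using C \<open>a \<noteq> b\<close> by blast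
  qed (use C \<open>a \<noteq> b\<close> \<open>a \<notin> A\<close> in auto)
qed

lemma commuting_swap_precedes:
  assumes "commuting_swap \<rho> \<sigma>" "\<not> commuting A B"
  shows "precedes \<rho> A B \<longleftrightarrow> precedes \<sigma> A B"
  using assms by cases (auto simp: precedes_append commuting_def)

lemma commuting_swaps_precedes:
  assumes "commuting_swap\<^sup>*\<^sup>* \<rho> \<sigma>" "\<not> commuting A B"
  shows "precedes \<rho> A B \<longleftrightarrow> precedes \<sigma> A B"
  using assms by (induction rule: rtranclp_induct) (auto simp: commuting_swap_precedes)

lemma commuting_swap_Cons: "commuting_swap \<rho> \<sigma> \<Longrightarrow> commuting_swap (x # \<rho>) (x # \<sigma>)"
  by (erule commuting_swap.cases) (metis append_Cons commuting_swap.intros)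

lemma commuting_swaps_Cons: "commuting_swap\<^sup>*\<^sup>* \<rho> \<sigma> \<Longrightarrow> commuting_swap\<^sup>*\<^sup>* (x # \<rho>) (x # \<sigma>)"
  by (induction rule: rtranclp_induct) (auto intro: commuting_swap_Cons rtranclp.rtrancl_into_rtrancl)

lemma commuting_swaps_to_front:
  assumes "\<forall>u\<in>set us. commuting x u"
  shows "commuting_swap\<^sup>*\<^sup>* (x # us @ vs) (us @ x # vs)"
  using assms
proof (induction us)
  case (Cons u us)
  have "commuting_swap (x # u # us @ vs) (u # x # us @ vs)"
    using commuting_swap.intros[of x u "[]" "us @ vs"] Cons.prems by simp
  moreover have "commuting_swap\<^sup>*\<^sup>* (u # x # us @ vs) (u # us @ x # vs)"
    using Cons by (intro commuting_swaps_Cons) simp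
  ultimately show ?case by simp
qed simp

text \<open>If some \<open>u\<close> before the head \<open>x\<close> of the first list in
  \<open>\<sigma>\<close> failed to commute with \<open>x\<close>, the hypothesis would put
  \<open>x\<close> before \<open>u\<close> in \<open>\<sigma>\<close>. So \<open>x\<close> can be
  swapped to the front of \<open>\<sigma>\<close>, and induction handles the rest. In trace monoids,
  likewise, the order of dependent letters determines the trace.\<close>

lemma commuting_swaps_if_precedes:
  assumes "distinct \<rho>" "distinct \<sigma>" "set \<rho> = set \<sigma>"
    and "\<And>A B. A \<noteq> B \<Longrightarrow> \<not> commuting A B \<Longrightarrow> precedes \<rho> A B \<Longrightarrow> precedes \<sigma> A B"
  shows "commuting_swap\<^sup>*\<^sup>* \<rho> \<sigma>"
  using assms
proof (induction \<rho> arbitrary: \<sigma>)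
  case (Cons x \<rho>)
  then obtain us vs where \<sigma>: "\<sigma> = us @ x # vs"
    by (metis list.set_intros(1) split_list)
  with Cons.prems have x: "x \<notin> set us" "x \<notin> set vs"
    by auto
  have "insert x (set \<rho>) = insert x (set (us @ vs))" using Cons.prems(3) by (auto simp: \<sigma>)
  then have set_eq: "set \<rho> = set (us @ vs)"
    using x Cons.prems(1) by (subst (asm) insert_ident) auto
  have "commuting x u" if "u \<in> set us" for u
  proof (rule ccontr)
    assume "\<not> commuting x u"
    moreover have "precedes (x # \<rho>) x u" "u \<noteq> x" using that x set_eq by auto
    ultimately have "precedes \<sigma> x u" using Cons.prems(4) by blast
    with that x show False by (auto simp: \<sigma> precedes_append dest: precedes_in_set)
        (use Cons.prems(2) \<sigma> in auto)
  qed
  moreover have "commuting_swap\<^sup>*\<^sup>* \<rho> (us @ vs)"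
  proof (rule Cons.IH)
    show "precedes (us @ vs) A B" if "A \<noteq> B" "\<not> commuting A B" "precedes \<rho> A B" for A B
    proof -
      have "precedes \<sigma> A B" "A \<in> set \<rho>" "B \<in> set \<rho>"
        using that Cons.prems(4)[of A B] precedes_in_set[of \<rho> A B] by auto
      then show ?thesis using x set_eq Cons.prems(1) by (auto simp: \<sigma> precedes_append)
    qed
  qed (use Cons.prems x set_eq \<sigma> in auto)
  ultimately show ?case
    unfolding \<sigma> by (meson commuting_swaps_Cons commuting_swaps_to_front rtranclp_trans)
qed simp

text \<open>Distinct members of one packet never commute, so swaps preserve inversions. Conversely,
  distinct sets that do not commute share a packet, so the inversion set fixes the order of each
  such pair. For \<open>k \<ge> 1\<close> every packet has two members to compare.\<close>

lemma commutation_equiv_iff: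
  assumes "k \<ge> 1" "\<rho> \<in> admissible_orders n k" "\<sigma> \<in> admissible_orders n k"
  shows "(\<rho>, \<sigma>) \<in> commutation_equiv n k \<longleftrightarrow> inversions n k \<rho> = inversions n k \<sigma>"
proof
  assume "(\<rho>, \<sigma>) \<in> commutation_equiv n k"
  then have swaps: "commuting_swap\<^sup>*\<^sup>* \<rho> \<sigma>" by (simp add: commutation_equiv_def)
  have "X \<in> inversions n k \<rho> \<longleftrightarrow> X \<in> inversions n k \<sigma>" if X: "X \<in> nsets {1..n} (k + 1)" for X
  proof -
    obtain a b where ab: "a \<in> X" "b \<in> X" "a < b" using nsets_two_elements X assms(1) .
    then have "\<not> commuting (X - {a}) (X - {b})"
      by (intro not_commuting_packet[of _ X]) (auto simp: packet_def)
    then show ?thesis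
      using inversions_iff X ab assms commuting_swaps_precedes[OF swaps] by metis
  qed
  then show "inversions n k \<rho> = inversions n k \<sigma>"
    by (auto simp: inversions_def)
next
  assume eq: "inversions n k \<rho> = inversions n k \<sigma>"
  have dist: "distinct \<rho>" "distinct \<sigma>" "set \<rho> = nsets {1..n} k" "set \<sigma> = nsets {1..n} k"
    using assms by (auto simp: admissible_orders_iff)
  have "commuting_swap\<^sup>*\<^sup>* \<rho> \<sigma>"
  proof (rule commuting_swaps_if_precedes)
    fix A B assume AB: "A \<noteq> B" "\<not> commuting A B" "precedes \<rho> A B"
    then have "A \<in> nsets {1..n} k" "B \<in> nsets {1..n} k"
      using precedes_in_set dist by metis+
    from not_commuting_nsets[OF AB(2) this AB(1)]
    obtain X a b where X: "X \<in> nsets {1..n} (k + 1)" "a \<in> X" "b \<in> X" "a \<noteq> b"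
      "A = X - {a}" "B = X - {b}" .
    have "X - {a} \<noteq> X - {b}" using X by blast
    moreover have "X - {a} \<in> set \<sigma>" "X - {b} \<in> set \<sigma>"
      using remove_in_nsets[OF X(1)] X(2,3) dist(4) by simp_all
    ultimately have "precedes \<sigma> (X - {b}) (X - {a}) \<or> precedes \<sigma> (X - {a}) (X - {b})"
      by (meson precedes_total)
    then show "precedes \<sigma> A B"
      using inversions_iff[OF assms(2) X(1), of a b] inversions_iff[OF assms(2) X(1), of b a]
        inversions_iff[OF assms(3) X(1), of a b] inversions_iff[OF assms(3) X(1), of b a]
        X eq AB(3) precedes_asym[OF dist(1)] by (metis linorder_neqE_nat)
  qed (use dist in auto)
  then show "(\<rho>, \<sigma>) \<in> commutation_equiv n k"
    using assms by (simp add: commutation_equiv_def)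
qed

lemma card_quotient_kernel:
  assumes "R \<subseteq> A \<times> A" "\<And>x y. x \<in> A \<Longrightarrow> y \<in> A \<Longrightarrow> (x, y) \<in> R \<longleftrightarrow> f x = f y"
  shows "card (A // R) = card (f ` A)"
proof -
  have class_eq: "R `` {x} = {y \<in> A. f y = f x}" if "x \<in> A" for x
    using that assms by auto
  have "A // R = (\<lambda>v. {y \<in> A. f y = v}) ` f ` A"
    by (auto simp: quotient_def class_eq image_image)
  moreover have "inj_on (\<lambda>v. {y \<in> A. f y = v}) (f ` A)"
    by (rule inj_onI) blast
  ultimately show ?thesis by (simp add: card_image)
qed

lemma card_higher_bruhat:
  assumes "k \<ge> 1"
  shows "card (higher_bruhat n k) = card (inversions n k ` admissible_orders n k)"
  unfolding higher_bruhat_def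
proof (rule card_quotient_kernel)
  show "commutation_equiv n k \<subseteq> admissible_orders n k \<times> admissible_orders n k"
    by (auto simp: commutation_equiv_def)
qed (rule commutation_equiv_iff[OF assms])

section \<open>Deletion and contraction\<close>

definition deletion :: "nat \<Rightarrow> nat set list \<Rightarrow> nat set list" where
  "deletion m \<rho> = filter (\<lambda>A. m \<notin> A) \<rho>"

text \<open>The order induced on the link of \<open>m\<close>. For \<open>m = n + 1\<close> it
  lowers both parameters of the Bruhat order by one.\<close>

definition contraction :: "nat \<Rightarrow> nat set list \<Rightarrow> nat set list" where
  "contraction m \<rho> = map (\<lambda>A. A - {m}) (filter (\<lambda>A. m \<in> A) \<rho>)"

lemma nsets_Suc_mem_iff: "X \<in> nsets {1..n} k \<longleftrightarrow> X \<in> nsets {1..Suc n} k \<and> Suc n \<notin> X"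
  by (auto simp: nsets_def le_Suc_eq)

lemma nsets_insert_iff:
  "Y \<in> nsets {1..n} k \<longleftrightarrow> insert (Suc n) Y \<in> nsets {1..Suc n} (Suc k) \<and> Suc n \<notin> Y"
  by (auto simp: nsets_def le_Suc_eq card_insert_if)

lemma precedes_deletion:
  "precedes (deletion m \<rho>) A B \<longleftrightarrow> precedes \<rho> A B \<and> m \<notin> A \<and> m \<notin> B"
  by (simp add: deletion_def precedes_filter)

lemma inj_on_remove: "inj_on (\<lambda>A. A - {m}) {A. m \<in> A}"
  by (rule inj_onI) (metis insert_Diff mem_Collect_eq)

lemma precedes_contraction:
  assumes "A \<in> set \<rho>" "B \<in> set \<rho>" "m \<in> A" "m \<in> B"
  shows "precedes (contraction m \<rho>) (A - {m}) (B - {m}) \<longleftrightarrow> precedes \<rho> A B"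
proof -
  have "inj_on (\<lambda>A. A - {m}) (set (filter (\<lambda>A. m \<in> A) \<rho>))"
    by (rule inj_on_subset[OF inj_on_remove]) auto
  from precedes_map[OF this, of A B] show ?thesis
    using assms by (simp add: contraction_def precedes_filter)
qed

lemma packet_deletion:
  assumes "X \<in> nsets {1..n} j"
  shows "lex_on_packet (deletion (Suc n) \<rho>) X \<longleftrightarrow> lex_on_packet \<rho> X"
    and "antilex_on_packet (deletion (Suc n) \<rho>) X \<longleftrightarrow> antilex_on_packet \<rho> X"
proof -
  have "Suc n \<notin> X" using assms by (auto simp: nsets_def)
  then show "lex_on_packet (deletion (Suc n) \<rho>) X \<longleftrightarrow> lex_on_packet \<rho> X"
    "antilex_on_packet (deletion (Suc n) \<rho>) X \<longleftrightarrow> antilex_on_packet \<rho> X"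
    by (simp_all add: lex_on_packet_def antilex_on_packet_def precedes_deletion)
qed

lemma deletion_admissible:
  assumes "\<rho> \<in> admissible_orders (Suc n) k"
  shows "deletion (Suc n) \<rho> \<in> admissible_orders n k"
  unfolding admissible_orders_iff
proof (intro conjI ballI)
  show "set (deletion (Suc n) \<rho>) = nsets {1..n} k"
    using assms unfolding admissible_orders_iff
    by (subst set_eq_iff, subst nsets_Suc_mem_iff) (simp add: deletion_def)
  show "lex_on_packet (deletion (Suc n) \<rho>) X \<or> antilex_on_packet (deletion (Suc n) \<rho>) X"
    if "X \<in> nsets {1..n} (k + 1)" for X
    using that packet_deletion[OF that] nsets_Suc_mem_iff[of X n] assms
    unfolding admissible_orders_iff by simp
qed (use assms in \<open>auto simp: admissible_orders_iff deletion_def\<close>)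

lemma inversions_deletion:
  "inversions n k (deletion (Suc n) \<rho>) = {X \<in> inversions (Suc n) k \<rho>. Suc n \<notin> X}"
  using nsets_Suc_mem_iff[of _ n "k + 1"] packet_deletion[of _ n "k + 1"]
  by (auto simp: inversions_def)

text \<open>The packet of \<open>Y\<close> is obtained from the packet of
  \<open>insert (Suc n) Y\<close> by keeping the members that contain \<open>Suc n\<close> and
  dropping \<open>Suc n\<close> from them, so lex and antilex are inherited.\<close>

lemma precedes_contraction_packet:
  assumes "set \<rho> = nsets {1..Suc n} (Suc k)" "Y \<in> nsets {1..n} (k + 1)" "a \<in> Y" "b \<in> Y"
  shows "precedes (contraction (Suc n) \<rho>) (Y - {a}) (Y - {b}) \<longleftrightarrow>
         precedes \<rho> (insert (Suc n) Y - {a}) (insert (Suc n) Y - {b})"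
proof -
  let ?X = "insert (Suc n) Y"
  have X: "?X \<in> nsets {1..Suc n} (Suc k + 1)" "Suc n \<notin> Y"
    using assms(2) nsets_insert_iff[of Y n "k + 1"] by auto
  have "precedes (contraction (Suc n) \<rho>) (?X - {a} - {Suc n}) (?X - {b} - {Suc n}) \<longleftrightarrow>
        precedes \<rho> (?X - {a}) (?X - {b})"
  proof (rule precedes_contraction)
    show "?X - {a} \<in> set \<rho>" "?X - {b} \<in> set \<rho>"
      using remove_in_nsets[OF X(1)] assms by auto
  qed (use X assms in auto)
  moreover have "?X - {c} - {Suc n} = Y - {c}" for c using X(2) by auto
  ultimately show ?thesis by simp
qed

lemma contraction_admissible:
  assumes "\<rho> \<in> admissible_orders (Suc n) (Suc k)"
  shows "contraction (Suc n) \<rho> \<in> admissible_orders n k"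
  unfolding admissible_orders_iff
proof (intro conjI ballI)
  have \<rho>: "distinct \<rho>" "set \<rho> = nsets {1..Suc n} (Suc k)"
    using assms by (auto simp: admissible_orders_iff)
  show "distinct (contraction (Suc n) \<rho>)"
    unfolding contraction_def distinct_map using \<rho>(1)
    by (auto intro: inj_on_subset[OF inj_on_remove])
  show "set (contraction (Suc n) \<rho>) = nsets {1..n} k"
  proof (intro set_eqI iffI)
    fix A assume "A \<in> set (contraction (Suc n) \<rho>)"
    then obtain B where "A = B - {Suc n}" "Suc n \<in> B" "B \<in> nsets {1..Suc n} (Suc k)"
      by (auto simp: contraction_def \<rho>(2))
    then show "A \<in> nsets {1..n} k"
      by (subst nsets_insert_iff) (auto simp: insert_absorb)
  next
    fix A assume "A \<in> nsets {1..n} k"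
    then have "insert (Suc n) A \<in> set \<rho>" "A = insert (Suc n) A - {Suc n}"
      using nsets_insert_iff[of A n k] \<rho>(2) by auto
    then show "A \<in> set (contraction (Suc n) \<rho>)"
      unfolding contraction_def set_map set_filter by (intro image_eqI[of _ _ "insert (Suc n) A"]) simp_all
  qed
  show "lex_on_packet (contraction (Suc n) \<rho>) Y \<or> antilex_on_packet (contraction (Suc n) \<rho>) Y"
    if Y: "Y \<in> nsets {1..n} (k + 1)" for Y
  proof -
    have "insert (Suc n) Y \<in> nsets {1..Suc n} (Suc k + 1)"
      using Y nsets_insert_iff[of Y n "k + 1"] by simp
    then have "lex_on_packet \<rho> (insert (Suc n) Y) \<or> antilex_on_packet \<rho> (insert (Suc n) Y)"
      using assms by (simp only: admissible_orders_iff)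
    then show ?thesis
      by (simp add: lex_on_packet_def antilex_on_packet_def precedes_contraction_packet[OF \<rho>(2) Y]
          del: insert_iff) blast
  qed
qed

lemma inversions_contraction:
  assumes "\<rho> \<in> admissible_orders (Suc n) (Suc k)" "k \<ge> 1"
  shows "inversions n k (contraction (Suc n) \<rho>) =
    {Y. Suc n \<notin> Y \<and> insert (Suc n) Y \<in> inversions (Suc n) (Suc k) \<rho>}"
proof -
  have \<rho>: "set \<rho> = nsets {1..Suc n} (Suc k)"
    using assms by (auto simp: admissible_orders_iff)
  have "Y \<in> inversions n k (contraction (Suc n) \<rho>) \<longleftrightarrow>
        insert (Suc n) Y \<in> inversions (Suc n) (Suc k) \<rho>"
    if Y: "Y \<in> nsets {1..n} (k + 1)" for Y
  proof -
    obtain a b where ab: "a \<in> Y" "b \<in> Y" "a < b" using nsets_two_elements Y assms(2) .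
    have X: "insert (Suc n) Y \<in> nsets {1..Suc n} (Suc k + 1)"
      using Y nsets_insert_iff[of Y n "k + 1"] by simp
    show ?thesis
      using inversions_iff[OF contraction_admissible[OF assms(1)] Y ab]
        inversions_iff[OF assms(1) X _ _ ab(3)] ab precedes_contraction_packet[OF \<rho> Y, of a b]
      by simp
  qed
  moreover have "Y \<in> nsets {1..n} (k + 1)"
    if "Suc n \<notin> Y" "insert (Suc n) Y \<in> inversions (Suc n) (Suc k) \<rho>" for Y
    using that nsets_insert_iff[of Y n "k + 1"] by (simp add: inversions_def)
  moreover have "Y \<in> nsets {1..n} (k + 1)" if "Y \<in> inversions n k (contraction (Suc n) \<rho>)" for Y
    using that by (simp add: inversions_def)
  ultimately show ?thesis
    using nsets_Suc_mem_iff by blast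
qed

text \<open>An inversion set is recovered from two pieces: its members avoiding
  \<open>Suc n\<close>, which are the inversions of the deletion, and its members containing
  \<open>Suc n\<close>, which become the inversions of the contraction once \<open>Suc n\<close> is
  dropped.\<close>

lemma card_inversions_Suc_le:
  assumes "k \<ge> 1"
  shows "card (inversions (Suc n) (Suc k) ` admissible_orders (Suc n) (Suc k)) \<le>
    card (inversions n (Suc k) ` admissible_orders n (Suc k)) *
    card (inversions n k ` admissible_orders n k)"
    (is "card ?A \<le> card ?B * card ?C")
proof -
  define split where
    "split S = ({X \<in> S. Suc n \<notin> X}, {Y. Suc n \<notin> Y \<and> insert (Suc n) Y \<in> S})" for S :: "nat set set"
  have "inj split"
  proof (rule injI)
    fix S T assume eq: "split S = split T"
    have "X \<in> S \<longleftrightarrow> X \<in> T" for X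
    proof (cases "Suc n \<in> X")
      case True
      then have "X \<in> U \<longleftrightarrow> X - {Suc n} \<in> snd (split U)" for U
        by (simp add: split_def insert_absorb)
      with eq show ?thesis by metis
    next
      case False
      then have "X \<in> U \<longleftrightarrow> X \<in> fst (split U)" for U
        by (simp add: split_def)
      with eq show ?thesis by metis
    qed
    then show "S = T" by blast
  qed
  moreover have "split ` ?A \<subseteq> ?B \<times> ?C"
  proof clarify
    fix \<rho> B C assume \<rho>: "\<rho> \<in> admissible_orders (Suc n) (Suc k)"
      and "(B, C) = split (inversions (Suc n) (Suc k) \<rho>)"
    then have "B = inversions n (Suc k) (deletion (Suc n) \<rho>)"
      "C = inversions n k (contraction (Suc n) \<rho>)"
      by (simp_all add: split_def inversions_deletion inversions_contraction[OF \<rho> assms])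
    then show "B \<in> ?B \<and> C \<in> ?C"
      using deletion_admissible contraction_admissible \<rho> by blast
  qed
  ultimately have "card ?A \<le> card (?B \<times> ?C)"
    by (intro card_inj_on_le) (auto intro: inj_on_subset simp: finite_admissible_orders)
  then show ?thesis by (simp add: card_cartesian_product)
qed

section \<open>Rows of orders on pairs\<close>

text \<open>Read the pair \<open>{i, j}\<close> as the crossing of pseudolines \<open>i\<close> and
  \<open>j\<close>. Row \<open>i\<close> lists the crossings along pseudoline \<open>i\<close>, and
  for \<open>e\<close> in this row the size of the set is the position of \<open>e\<close>, counted
  from 0.\<close>

definition row_below :: "nat set list \<Rightarrow> nat \<Rightarrow> nat set \<Rightarrow> nat set set" where
  "row_below \<rho> i e = {f. i \<in> f \<and> precedes \<rho> f e}"

text \<open>The set records where smaller indices cross pseudoline \<open>i\<close>, but not which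
  index crosses at which place.\<close>

definition left_ranks :: "nat set list \<Rightarrow> nat \<Rightarrow> nat set" where
  "left_ranks \<rho> i = (\<lambda>j. card (row_below \<rho> i {i, j})) ` {1..<i}"

lemma finite_row_below [simp]: "finite (row_below \<rho> i e)"
proof (rule finite_subset)
  show "row_below \<rho> i e \<subseteq> set \<rho>"
    using precedes_in_set[of \<rho> _ e] by (auto simp: row_below_def)
qed simp

lemma card_row_below_less:
  assumes "distinct \<rho>" "precedes \<rho> e f" "i \<in> e"
  shows "card (row_below \<rho> i e) < card (row_below \<rho> i f)"
proof (rule psubset_card_mono)
  have "e \<in> row_below \<rho> i f" "e \<notin> row_below \<rho> i e"
    using assms precedes_asym[OF assms(1), of e e] by (auto simp: row_below_def)
  moreover have "row_below \<rho> i e \<subseteq> row_below \<rho> i f"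
    using precedes_trans[OF assms(1) _ assms(2)] by (auto simp: row_below_def)
  ultimately show "row_below \<rho> i e \<subset> row_below \<rho> i f" by blast
qed simp

lemma card_row_below_eqD:
  assumes "distinct \<rho>" "e \<in> set \<rho>" "f \<in> set \<rho>" "i \<in> e" "i \<in> f"
    and "card (row_below \<rho> i e) = card (row_below \<rho> i f)"
  shows "e = f"
proof (rule ccontr)
  assume "e \<noteq> f"
  then have "precedes \<rho> e f \<or> precedes \<rho> f e" using assms(2,3) by (rule precedes_total[rotated 2])
  then show False
    using card_row_below_less[OF assms(1) _ assms(4)] card_row_below_less[OF assms(1) _ assms(5)]
      assms(6) by fastforce
qed

lemma precedes_first:
  assumes "S \<subseteq> set xs" "S \<noteq> {}"
  obtains g where "g \<in> S" "\<And>h. h \<in> S \<Longrightarrow> h \<noteq> g \<Longrightarrow> precedes xs g h"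
proof -
  have "\<exists>g\<in>S. \<forall>h\<in>S. h \<noteq> g \<longrightarrow> precedes xs g h"
    using assms
  proof (induction xs)
    case (Cons x xs)
    show ?case
    proof (cases "x \<in> S")
      case True
      with Cons.prems show ?thesis by (intro bexI[of _ x]) auto
    next
      case False
      with Cons.prems have "S \<subseteq> set xs" by auto
      with Cons show ?thesis by auto
    qed
  qed simp
  then show ?thesis using that by blast
qed

lemma nsets_2_row:
  assumes "f \<in> nsets V 2" "i \<in> f"
  obtains x where "x \<in> V" "x \<noteq> i" "f = {i, x}"
proof -
  from assms(1) obtain a b where ab: "a \<in> V" "b \<in> V" "a \<noteq> b" "f = {a, b}"
    by (auto simp: nsets_def card_2_iff)
  show ?thesis
  proof (cases "i = a")
    case True
    with ab show ?thesis by (intro that[of b]) auto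
  next
    case False
    with ab assms(2) show ?thesis by (intro that[of a]) auto
  qed
qed

lemma admissible_triple:
  assumes "\<rho> \<in> admissible_orders n 2" "p \<in> {1..n}" "r \<in> {1..n}" "p < q" "q < r"
  shows "precedes \<rho> {p, q} {p, r} \<and> precedes \<rho> {p, r} {q, r} \<and> precedes \<rho> {p, q} {q, r} \<or>
         precedes \<rho> {q, r} {p, r} \<and> precedes \<rho> {p, r} {p, q} \<and> precedes \<rho> {q, r} {p, q}"
proof -
  let ?X = "{p, q, r}"
  have "?X \<in> nsets {1..n} (2 + 1)"
    using assms by (auto simp: nsets_def)
  then have "lex_on_packet \<rho> ?X \<or> antilex_on_packet \<rho> ?X"
    using assms(1) unfolding admissible_orders_iff by blast
  moreover have "?X - {p} = {q, r}" "?X - {q} = {p, r}" "?X - {r} = {p, q}"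
    using assms by auto
  ultimately show ?thesis
    using assms(4,5) unfolding lex_on_packet_def antilex_on_packet_def by auto
qed

text \<open>
  All elements that \<open>\<rho>\<close> places before \<open>{i, j}\<close> come first in every row of \<open>\<sigma>\<close>. If \<open>{i, x}\<close>
  and \<open>{y, j}\<close> are the next elements in rows \<open>i\<close> and \<open>j\<close> of \<open>\<sigma>\<close>, equality of the left ranks
  forces \<open>x > i\<close> and \<open>y < j\<close>, and admissibility then leaves only \<open>x = j\<close> and \<open>y = i\<close>.
\<close>

lemma row_below_eq:
  assumes \<rho>: "\<rho> \<in> admissible_orders n 2" and \<sigma>: "\<sigma> \<in> admissible_orders n 2"
    and ranks: "\<And>i. i \<in> {1..n} \<Longrightarrow> left_ranks \<rho> i = left_ranks \<sigma> i"
    and "e \<in> set \<rho>" "l \<in> e"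
  shows "row_below \<sigma> l e = row_below \<rho> l e"
  using \<open>e \<in> set \<rho>\<close> \<open>l \<in> e\<close>
proof (induction "card {f. precedes \<rho> f e}" arbitrary: e l rule: less_induct)
  case less
  have dist: "distinct \<rho>" "distinct \<sigma>" and set: "set \<rho> = nsets {1..n} 2" "set \<sigma> = nsets {1..n} 2"
    using \<rho> \<sigma> by (auto simp: admissible_orders_iff)
  note trans = precedes_trans[OF dist(1)] precedes_trans[OF dist(2)]
  note asym = precedes_asym[OF dist(1)] precedes_asym[OF dist(2)]
  define U where "U f \<longleftrightarrow> precedes \<rho> f e" for f
  have U_downward: "U f" if "precedes \<rho> f g" "U g" for f g
    using that trans(1) by (auto simp: U_def)
  have IH: "row_below \<sigma> m f = row_below \<rho> m f" if "U f" "m \<in> f" for f m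
  proof (rule less.hyps)
    have "precedes \<rho> f e" using that by (simp add: U_def)
    then have "{g. precedes \<rho> g f} \<subset> {g. precedes \<rho> g e}"
      using trans(1) asym(1) by blast
    moreover have "finite {g. precedes \<rho> g e}"
      by (rule finite_subset[of _ "set \<rho>"]) (auto dest: precedes_in_set)
    ultimately show "card {g. precedes \<rho> g f} < card {g. precedes \<rho> g e}"
      by (rule psubset_card_mono[rotated])
    show "f \<in> set \<rho>" "m \<in> f" using that precedes_in_set[of \<rho> f e] by (auto simp: U_def)
  qed
  \<comment> \<open>If \<open>g\<close> came before \<open>f\<close> in \<open>\<sigma>\<close>, the
    induction hypothesis for \<open>f\<close> would put \<open>g\<close> before \<open>f\<close> in
    \<open>\<rho>\<close> too, and \<open>U\<close> is closed downward.\<close>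
  have U_first: "precedes \<sigma> f g" if "U f" "\<not> U g" "g \<in> set \<sigma>" "m \<in> f" "m \<in> g" for f g m
  proof (rule ccontr)
    assume "\<not> precedes \<sigma> f g"
    moreover have "f \<in> set \<sigma>" "f \<noteq> g" using that precedes_in_set[of \<rho> f e] set by (auto simp: U_def)
    ultimately have "precedes \<sigma> g f" using that precedes_total by metis
    then have "g \<in> row_below \<rho> m f" using IH[of f m] that by (auto simp: row_below_def)
    then show False using U_downward[of g f] that by (simp add: row_below_def)
  qed
  have not_U_e: "\<not> U e" using asym(1)[of e e] by (auto simp: U_def)
  have not_U_after: "precedes \<rho> e g" if "g \<in> set \<rho>" "\<not> U g" "g \<noteq> e" for g
    using that less.prems precedes_total[of g \<rho> e] by (auto simp: U_def)
  \<comment> \<open>Take the first pair of row \<open>m\<close> of \<open>\<sigma>\<close> outside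
    \<open>U\<close>. Its predecessors in the row are exactly the members of \<open>U\<close> there,
    so its position in \<open>\<sigma>\<close> is that of \<open>e\<close> in
    \<open>\<rho>\<close>.\<close>
  have next_in_row: "\<exists>g. g \<in> set \<sigma> \<and> m \<in> g \<and> \<not> U g \<and>
      (\<forall>h\<in>set \<sigma>. m \<in> h \<longrightarrow> \<not> U h \<longrightarrow> h \<noteq> g \<longrightarrow> precedes \<sigma> g h) \<and>
      row_below \<sigma> m g = row_below \<rho> m e" if "m \<in> e" for m
  proof -
    let ?S = "{g \<in> set \<sigma>. m \<in> g \<and> \<not> U g}"
    have "e \<in> ?S" using that less.prems set not_U_e by auto
    then have "?S \<subseteq> set \<sigma>" "?S \<noteq> {}" by auto
    then obtain g where g: "g \<in> ?S" and first: "\<And>h. h \<in> ?S \<Longrightarrow> h \<noteq> g \<Longrightarrow> precedes \<sigma> g h"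
      by (rule precedes_first) blast
    have "row_below \<sigma> m g = row_below \<rho> m e"
    proof (intro set_eqI iffI)
      fix f assume "f \<in> row_below \<sigma> m g"
      then have f: "m \<in> f" "precedes \<sigma> f g" by (simp_all add: row_below_def)
      then have "f \<noteq> g" "\<not> precedes \<sigma> g f" "f \<in> set \<sigma>"
        using asym(2) precedes_in_set by metis+
      then have "U f" using first[of f] f(1) by blast
      with f(1) show "f \<in> row_below \<rho> m e" by (simp add: row_below_def U_def)
    next
      fix f assume "f \<in> row_below \<rho> m e"
      then have f: "m \<in> f" "U f" by (simp_all add: row_below_def U_def)
      with g show "f \<in> row_below \<sigma> m g" using U_first[of f g m]
        by (simp add: row_below_def)
    qed
    with g first show ?thesis by blast
  qed
  obtain i j where e: "e = {i, j}" "i < j" "i \<in> {1..n}" "j \<in> {1..n}"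
    using less.prems(1) unfolding set ordered_nsets_2_eq by auto
  obtain gi where gi: "gi \<in> set \<sigma>" "i \<in> gi" "\<not> U gi"
    and first_i: "\<And>h. h \<in> set \<sigma> \<Longrightarrow> i \<in> h \<Longrightarrow> \<not> U h \<Longrightarrow> h \<noteq> gi \<Longrightarrow> precedes \<sigma> gi h"
    and below_i: "row_below \<sigma> i gi = row_below \<rho> i e"
    using next_in_row[of i] e(1) by blast
  obtain gj where gj: "gj \<in> set \<sigma>" "j \<in> gj" "\<not> U gj"
    and first_j: "\<And>h. h \<in> set \<sigma> \<Longrightarrow> j \<in> h \<Longrightarrow> \<not> U h \<Longrightarrow> h \<noteq> gj \<Longrightarrow> precedes \<sigma> gj h"
    and below_j: "row_below \<sigma> j gj = row_below \<rho> j e"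
    using next_in_row[of j] e(1) by blast
  obtain x where x: "gi = {i, x}" "x \<noteq> i" "x \<in> {1..n}"
    using gi(1,2) nsets_2_row unfolding set by metis
  have e_in: "{i, j} \<in> set \<sigma>" "{i, j} \<in> set \<rho>"
    using e(2-4) unfolding set by simp_all
  \<comment> \<open>Otherwise the position of \<open>{i, x}\<close> is a left rank of
    \<open>\<sigma>\<close>, hence of \<open>\<rho>\<close>; but in row \<open>i\<close> of
    \<open>\<rho>\<close> this position belongs to \<open>{i, j}\<close>, where
    \<open>j > i\<close>.\<close>
  have "i < x"
  proof (rule ccontr)
    assume "\<not> i < x"
    then have "card (row_below \<sigma> i {i, x}) \<in> left_ranks \<sigma> i"
      using x unfolding left_ranks_def by auto
    then have "card (row_below \<sigma> i {i, x}) \<in> left_ranks \<rho> i"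
      using ranks[OF e(3)] by simp
    then obtain j' where j': "j' \<in> {1..<i}"
      "card (row_below \<sigma> i {i, x}) = card (row_below \<rho> i {i, j'})"
      unfolding left_ranks_def by blast
    have "{i, j'} = {i, j}"
      using j' below_i e e_in x set
      by (intro card_row_below_eqD[OF dist(1), of _ _ i]) auto
    with j'(1) e(2) show False by (auto simp: doubleton_eq_iff)
  qed
  \<comment> \<open>In row \<open>j\<close>, conversely, the position of \<open>{i, j}\<close> is a
    left rank because \<open>i < j\<close>, so \<open>\<sigma>\<close> also has a smaller index
    there.\<close>
  obtain y where y: "gj = {y, j}" "y < j" "y \<in> {1..n}"
  proof -
    have "card (row_below \<rho> j {j, i}) \<in> left_ranks \<rho> j"
      using e unfolding left_ranks_def by auto
    then have "card (row_below \<rho> j {j, i}) \<in> left_ranks \<sigma> j"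
      using ranks[OF e(4)] by simp
    then obtain y where y: "y \<in> {1..<j}"
      "card (row_below \<rho> j {j, i}) = card (row_below \<sigma> j {j, y})"
      unfolding left_ranks_def by blast
    have "gj = {j, y}"
      using y below_j e gj set
      by (intro card_row_below_eqD[OF dist(2), of _ _ j]) (auto simp: insert_commute)
    with y(1) e(4) show ?thesis by (intro that[of y]) auto
  qed
  note first_i = first_i[unfolded x(1)] and first_j = first_j[unfolded y(1)]
  note notU = gi(3)[unfolded x(1)] gj(3)[unfolded y(1)] not_U_e[unfolded e(1)]
  note not_U_after = not_U_after[unfolded e(1)]
  have triple_\<rho>: "precedes \<rho> {p, q} {p, r} \<and> precedes \<rho> {p, r} {q, r} \<and> precedes \<rho> {p, q} {q, r} \<or>
         precedes \<rho> {q, r} {p, r} \<and> precedes \<rho> {p, r} {p, q} \<and> precedes \<rho> {q, r} {p, q}"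
    if "p < q" "q < r" "p \<in> {1..n}" "r \<in> {1..n}" for p q r
    using admissible_triple[OF \<rho>] that by blast
  have triple_\<sigma>: "precedes \<sigma> {p, q} {p, r} \<and> precedes \<sigma> {p, r} {q, r} \<and> precedes \<sigma> {p, q} {q, r} \<or>
         precedes \<sigma> {q, r} {p, r} \<and> precedes \<sigma> {p, r} {p, q} \<and> precedes \<sigma> {q, r} {p, q}"
    if "p < q" "q < r" "p \<in> {1..n}" "r \<in> {1..n}" for p q r
    using admissible_triple[OF \<sigma>] that by blast
  have U_\<rho>: "U f" if "precedes \<rho> f {i, j}" for f using that e by (simp add: U_def)
  have ix: "precedes \<sigma> {i, x} {i, j}" if "x \<noteq> j"
    using first_i[of "{i, j}"] that e_in notU by (auto simp: doubleton_eq_iff)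
  have yj: "precedes \<sigma> {y, j} {i, j}" if "y \<noteq> i"
    using first_j[of "{i, j}"] that e_in notU by (auto simp: doubleton_eq_iff)
  \<comment> \<open>For \<open>i < x < j\<close> the packet of \<open>{i, x, j}\<close> would be lex
    in \<open>\<sigma>\<close> and antilex in \<open>\<rho>\<close>. The latter puts
    \<open>{x, j}\<close> into \<open>U\<close>, so row \<open>x\<close> of \<open>\<sigma>\<close>
    has it before \<open>{i, x}\<close>, against lex.\<close>
  have "\<not> x < j"
  proof
    assume "x < j"
    then have "precedes \<sigma> {i, x} {x, j}"
      using triple_\<sigma>[OF \<open>i < x\<close> \<open>x < j\<close> e(3,4)] ix asym(2) by blast
    moreover have "precedes \<rho> {i, j} {i, x}"
      using \<open>x < j\<close> x gi set notU by (intro not_U_after) (auto simp: doubleton_eq_iff)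
    then have "U {x, j}"
      using triple_\<rho>[OF \<open>i < x\<close> \<open>x < j\<close> e(3,4)] asym(1) U_\<rho> by blast
    then have "precedes \<sigma> {x, j} {i, x}"
      using gi x notU by (intro U_first[of _ _ x]) auto
    ultimately show False using asym(2) by blast
  qed
  have "\<not> i < y"
  proof
    assume "i < y"
    then have "precedes \<sigma> {y, j} {i, y}"
      using triple_\<sigma>[OF \<open>i < y\<close> \<open>y < j\<close> e(3,4)] yj asym(2) by blast
    moreover have "precedes \<rho> {i, j} {y, j}"
      using \<open>i < y\<close> y gj set notU by (intro not_U_after) (auto simp: doubleton_eq_iff)
    then have "U {i, y}"
      using triple_\<rho>[OF \<open>i < y\<close> \<open>y < j\<close> e(3,4)] asym(1) U_\<rho> by blast
    then have "precedes \<sigma> {i, y} {y, j}"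
      using gj y notU by (intro U_first[of _ _ y]) auto
    ultimately show False using asym(2) by blast
  qed
  \<comment> \<open>Here the packet of \<open>{i, j, x}\<close> is antilex in
    \<open>\<sigma>\<close>. It is lex in \<open>\<rho>\<close> whenever \<open>{i, x}\<close> is
    outside \<open>U\<close>, which keeps \<open>{j, x}\<close> outside \<open>U\<close>.\<close>
  have jx: "precedes \<sigma> {j, x} {i, x} \<and> \<not> U {j, x}" if "j < x"
  proof -
    have "precedes \<sigma> {j, x} {i, x}"
      using triple_\<sigma>[OF e(2) that e(3) x(3)] ix that asym(2) by blast
    moreover have "\<not> U {j, x}"
    proof
      assume "U {j, x}"
      then have "precedes \<rho> {j, x} {i, j}" by (simp add: U_def e)
      then have "precedes \<rho> {i, x} {i, j}"
        using triple_\<rho>[OF e(2) that e(3) x(3)] asym(1) by blast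
      then show False using U_\<rho> notU by blast
    qed
    ultimately show ?thesis ..
  qed
  have jx_in: "{j, x} \<in> set \<sigma>" if "j < x" using that e x set by auto
  \<comment> \<open>Otherwise \<open>\<sigma>\<close> contains the cycle \<open>{i, x}\<close>,
    \<open>{y, i}\<close>, \<open>{y, j}\<close>, \<open>{j, x}\<close>, \<open>{i, x}\<close>, each
    pair preceding the next.\<close>
  have "\<not> y < i"
  proof
    assume "y < i"
    then have \<sigma>1: "precedes \<sigma> {y, i} {y, j}"
      using triple_\<sigma>[OF \<open>y < i\<close> e(2) y(3) e(4)] yj asym(2) by blast
    have "\<not> U {y, i}"
    proof
      assume "U {y, i}"
      then have "precedes \<rho> {y, i} {i, j}" by (simp add: U_def e)
      then have "precedes \<rho> {y, j} {i, j}"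
        using triple_\<rho>[OF \<open>y < i\<close> e(2) y(3) e(4)] asym(1) by blast
      then show False using U_\<rho> notU by blast
    qed
    moreover have "{y, i} \<in> set \<sigma>" using y e set \<open>y < i\<close> by auto
    ultimately have "precedes \<sigma> {i, x} {y, i}"
      using \<open>y < i\<close> \<open>i < x\<close> by (intro first_i) (auto simp: doubleton_eq_iff)
    with \<sigma>1 have \<sigma>2: "precedes \<sigma> {i, x} {y, j}" using trans(2) by blast
    then have "precedes \<sigma> {i, x} {i, j}" using yj \<open>y < i\<close> trans(2) by blast
    then have "x \<noteq> j" using asym(2) by blast
    with \<open>\<not> x < j\<close> have "j < x" by simp
    then have "precedes \<sigma> {y, j} {j, x}"
      using jx jx_in \<open>y < i\<close> e(2) by (intro first_j) (auto simp: doubleton_eq_iff)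
    with \<sigma>2 jx[OF \<open>j < x\<close>] show False using trans(2) asym(2) by blast
  qed
  with \<open>\<not> i < y\<close> have "y = i" by simp
  \<comment> \<open>For \<open>j < x\<close> the cycle is \<open>{i, j}\<close>,
    \<open>{j, x}\<close>, \<open>{i, x}\<close>, \<open>{i, j}\<close>.\<close>
  have "x = j"
  proof (rule ccontr)
    assume "x \<noteq> j"
    with \<open>\<not> x < j\<close> have "j < x" by simp
    then have "precedes \<sigma> {i, j} {j, x}"
      using first_j[of "{j, x}"] jx jx_in e(2) \<open>y = i\<close> by (auto simp: doubleton_eq_iff)
    with jx[OF \<open>j < x\<close>] ix[OF \<open>x \<noteq> j\<close>] show False using trans(2) asym(2) by blast
  qed
  then show ?case
    using less.prems(2) below_i below_j x(1) y(1) \<open>y = i\<close> e(1) by auto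
qed

text \<open>Two members of the packet of a triple share an element \<open>l\<close>, so row
  \<open>l\<close> shows their relative order.\<close>

lemma inversions_eq_if_left_ranks_eq:
  assumes \<rho>: "\<rho> \<in> admissible_orders n 2" and \<sigma>: "\<sigma> \<in> admissible_orders n 2"
    and ranks: "\<And>i. i \<in> {1..n} \<Longrightarrow> left_ranks \<rho> i = left_ranks \<sigma> i"
  shows "inversions n 2 \<rho> = inversions n 2 \<sigma>"
proof -
  have "antilex_on_packet \<rho> X \<longleftrightarrow> antilex_on_packet \<sigma> X" if X: "X \<in> nsets {1..n} (2 + 1)" for X
  proof -
    have "precedes \<rho> (X - {a}) (X - {b}) \<longleftrightarrow> precedes \<sigma> (X - {a}) (X - {b})"
      if "a \<in> X" "b \<in> X" for a b
    proof -
      have "card (X - {a, b}) > 0"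
        using X that by (cases "a = b") (auto simp: nsets_def card_Diff_subset)
      then obtain l where "l \<in> X - {a, b}" by (metis all_not_in_conv card_gt_0_iff)
      moreover have "X - {b} \<in> set \<rho>"
        using remove_in_nsets[OF X that(2)] \<rho> by (simp add: admissible_orders_iff)
      ultimately have "row_below \<sigma> l (X - {b}) = row_below \<rho> l (X - {b})" "l \<in> X - {a}"
        using row_below_eq[OF \<rho> \<sigma> ranks] by auto
      then show ?thesis by (auto simp: row_below_def set_eq_iff)
    qed
    then show ?thesis by (auto simp: antilex_on_packet_def)
  qed
  then show ?thesis by (auto simp: inversions_def)
qed

lemma left_ranks_in_nsets:
  assumes \<rho>: "\<rho> \<in> admissible_orders n 2" and i: "i \<in> {1..n}"
  shows "left_ranks \<rho> i \<in> nsets {0..<n - 1} (i - 1)"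
proof -
  have dist: "distinct \<rho>" and set: "set \<rho> = nsets {1..n} 2"
    using \<rho> by (auto simp: admissible_orders_iff)
  have "inj_on (\<lambda>j. card (row_below \<rho> i {i, j})) {1..<i}"
  proof (rule inj_onI)
    fix j j' assume j: "j \<in> {1..<i}" "j' \<in> {1..<i}"
      and "card (row_below \<rho> i {i, j}) = card (row_below \<rho> i {i, j'})"
    then have "{i, j} = {i, j'}"
      using i set by (intro card_row_below_eqD[OF dist, of _ _ i]) auto
    then show "j = j'" by (auto simp: doubleton_eq_iff)
  qed
  then have "card (left_ranks \<rho> i) = i - 1"
    by (simp add: left_ranks_def card_image)
  moreover have "card (row_below \<rho> i {i, j}) < n - 1" if j: "j \<in> {1..<i}" for j
  proof -
    have "row_below \<rho> i {i, j} \<subseteq> (\<lambda>x. {i, x}) ` ({1..n} - {i, j})"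
    proof
      fix f assume f: "f \<in> row_below \<rho> i {i, j}"
      then have "f \<in> nsets {1..n} 2" "i \<in> f" "f \<noteq> {i, j}"
        using precedes_in_set[of \<rho> f] precedes_asym[OF dist] set by (auto simp: row_below_def)
      then obtain x where "x \<in> {1..n}" "x \<noteq> i" "f = {i, x}"
        using nsets_2_row by metis
      with \<open>f \<noteq> {i, j}\<close> show "f \<in> (\<lambda>x. {i, x}) ` ({1..n} - {i, j})"
        by (intro image_eqI[of _ _ x]) auto
    qed
    then have "card (row_below \<rho> i {i, j}) \<le> card ({1..n} - {i, j})"
      using surj_card_le[of "{1..n} - {i, j}"] by blast
    also have "\<dots> = n - 2"
      using i j by (subst card_Diff_subset) auto
    \<comment> \<open>The existence of \<open>j < i\<close> forces \<open>n \<ge> 2\<close>, so the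
      truncated subtraction does no harm.\<close>
    also have "\<dots> < n - 1" using i j by auto
    finally show ?thesis .
  qed
  ultimately show ?thesis
    by (auto simp: nsets_def left_ranks_def)
qed

lemma card_inversions_2_le:
  "card (inversions n 2 ` admissible_orders n 2) \<le> (\<Prod>i = 1..n. (n - 1) choose (i - 1))"
proof -
  let ?ranks = "\<lambda>\<rho>. restrict (left_ranks \<rho>) {1..n}"
  let ?T = "\<Pi>\<^sub>E i\<in>{1..n}. nsets {0..<n - 1} (i - 1)"
  \<comment> \<open>Since the ranks determine the inversion set, \<open>g\<close> can read it off
    from an arbitrary admissible order with the given ranks.\<close>
  have "\<exists>g. \<forall>\<rho>\<in>admissible_orders n 2. inversions n 2 \<rho> = g (?ranks \<rho>)"
  proof
    show "\<forall>\<rho>\<in>admissible_orders n 2. inversions n 2 \<rho> =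
      (\<lambda>w. inversions n 2 (SOME \<rho>. \<rho> \<in> admissible_orders n 2 \<and> ?ranks \<rho> = w)) (?ranks \<rho>)"
    proof
      fix \<rho> assume \<rho>: "\<rho> \<in> admissible_orders n 2"
      define \<sigma> where "\<sigma> = (SOME \<sigma>. \<sigma> \<in> admissible_orders n 2 \<and> ?ranks \<sigma> = ?ranks \<rho>)"
      have \<sigma>: "\<sigma> \<in> admissible_orders n 2 \<and> ?ranks \<sigma> = ?ranks \<rho>"
        unfolding \<sigma>_def by (rule someI[of _ \<rho>]) (use \<rho> in simp)
      have "left_ranks \<rho> i = left_ranks \<sigma> i" if "i \<in> {1..n}" for i
        using fun_cong[OF conjunct2[OF \<sigma>], of i] that by simp
      then show "inversions n 2 \<rho> =
        (\<lambda>w. inversions n 2 (SOME \<rho>. \<rho> \<in> admissible_orders n 2 \<and> ?ranks \<rho> = w)) (?ranks \<rho>)"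
        using inversions_eq_if_left_ranks_eq[OF \<rho>] \<sigma> unfolding \<sigma>_def by auto
    qed
  qed
  then obtain g where "\<forall>\<rho>\<in>admissible_orders n 2. inversions n 2 \<rho> = g (?ranks \<rho>)" ..
  moreover have "?ranks ` admissible_orders n 2 \<subseteq> ?T"
    using left_ranks_in_nsets by auto
  ultimately have "inversions n 2 ` admissible_orders n 2 \<subseteq> g ` ?T" by auto
  moreover have "finite ?T" by (intro finite_PiE) (auto intro: finite_imp_finite_nsets)
  ultimately have "card (inversions n 2 ` admissible_orders n 2) \<le> card ?T"
    using surj_card_le by blast
  also have "card ?T = (\<Prod>i = 1..n. (n - 1) choose (i - 1))"
    unfolding binomial_eq_nsets by (rule card_PiE) simp
  finally show ?thesis .
qed

section \<open>Free choices on a layer of constant sum\<close>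

lemma precedes_sort_key:
  fixes K :: "'a \<Rightarrow> 'b :: linorder"
  assumes "A \<in> set xs" "B \<in> set xs" "K A < K B"
  shows "precedes (sort_key K xs) A B"
proof -
  have "sorted_wrt (\<lambda>A B. K A \<le> K B) (sort_key K xs)"
    using sorted_sort_key[of K xs] unfolding sorted_map .
  then have "\<not> precedes (sort_key K xs) B A"
    using assms(3) unfolding sorted_wrt_iff_precedes by (meson not_le)
  moreover have "A \<noteq> B" using assms(3) by auto
  ultimately show ?thesis using precedes_total[of A "sort_key K xs" B] assms by auto
qed

definition sum_layer :: "nat \<Rightarrow> nat \<Rightarrow> nat \<Rightarrow> nat set set" where
  "sum_layer n d s = {X \<in> nsets {1..n} d. \<Sum>X = s}"

text \<open>
  For \<open>I = {i\<^sub>1, \<dots>, i\<^sub>k}\<close> this is, up to the factor 2, the coordinate of the intersection point of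
  the hyperplanes \<open>i\<^sub>1, \<dots>, i\<^sub>k\<close> in a one-parameter deformation of the cyclic arrangement, that is
  \<open>h\<^sub>2(I) - s h\<^sub>1(I)\<close> for the complete homogeneous symmetric polynomials \<open>h\<^sub>1, h\<^sub>2\<close>.
\<close>

definition height :: "nat \<Rightarrow> nat set \<Rightarrow> int" where
  "height s I = (int (\<Sum>I))\<^sup>2 + (\<Sum>i\<in>I. (int i)\<^sup>2) - 2 * int s * int (\<Sum>I)"

text \<open>The sign of \<open>\<Sum>X - s\<close> alone decides in which direction the height runs
  along the whole packet of \<open>X\<close>, which makes the packet lex or antilex; on the layer
  \<open>\<Sum>X = s\<close> the whole packet is tied.\<close>

lemma height_diff:
  assumes "finite X" "a \<in> X" "b \<in> X"
  shows "height s (X - {a}) - height s (X - {b}) = 2 * (int b - int a) * (int (\<Sum>X) - int s)"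
proof -
  have sum1: "int (\<Sum>(X - {c})) = int (\<Sum>X) - int c" if "c \<in> X" for c
    using sum.remove[OF assms(1) that, of "\<lambda>x. x"] by simp
  have sum2: "(\<Sum>i\<in>X - {c}. (int i)\<^sup>2) = (\<Sum>i\<in>X. (int i)\<^sup>2) - (int c)\<^sup>2" if "c \<in> X" for c
    using sum.remove[OF assms(1) that, of "\<lambda>i. (int i)\<^sup>2"] by simp
  show ?thesis
    unfolding height_def sum1[OF assms(2)] sum1[OF assms(3)] sum2[OF assms(2)] sum2[OF assms(3)]
    by (simp add: power2_eq_square algebra_simps)
qed

text \<open>
  Packets of distinct sets in \<open>sum_layer n (k + 1) s\<close> are disjoint, since \<open>X\<close> is recovered from
  \<open>X - {a}\<close> by \<open>a = s - \<Sum>(X - {a})\<close>. Hence the ties of \<open>height s\<close> on these packets can be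
  broken independently.
\<close>

definition tie_break :: "nat \<Rightarrow> nat \<Rightarrow> nat set set \<Rightarrow> nat set \<Rightarrow> int" where
  "tie_break n s \<A> I =
     (let x = int s - int (\<Sum>I)
      in if x \<in> {1..int n} then if insert (nat x) I \<in> \<A> then x else - x else 0)"

lemma abs_tie_break_le: "\<bar>tie_break n s \<A> I\<bar> \<le> int n"
  by (auto simp: tie_break_def Let_def)

lemma tie_break_remove:
  assumes "X \<in> sum_layer n d s" "a \<in> X"
  shows "tie_break n s \<A> (X - {a}) = (if X \<in> \<A> then int a else - int a)"
proof -
  have X: "finite X" "\<Sum>X = s" "a \<in> {1..n}"
    using assms by (auto simp: sum_layer_def nsets_def)
  have "int s - int (\<Sum>(X - {a})) = int a"
    using sum.remove[OF X(1) assms(2), of "\<lambda>x. x"] X(2) by simp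
  then show ?thesis
    using X assms(2) by (simp add: tie_break_def insert_absorb)
qed

text \<open>Two tie breakers differ by at most \<open>2 * n\<close>, so the factor
  \<open>2 * n + 1\<close> lets any difference of the integer heights dominate.\<close>

definition tie_key :: "nat \<Rightarrow> nat \<Rightarrow> nat set set \<Rightarrow> nat set \<Rightarrow> int" where
  "tie_key n s \<A> I = (2 * int n + 1) * height s I + tie_break n s \<A> I"

lemma tie_key_less:
  assumes "height s I < height s J"
  shows "tie_key n s \<A> I < tie_key n s \<A> J"
proof -
  have "(2 * int n + 1) * (height s I + 1) \<le> (2 * int n + 1) * height s J"
    using assms by (intro mult_left_mono) auto
  then show ?thesis
    using abs_tie_break_le[of n s \<A> I] abs_tie_break_le[of n s \<A> J]
    by (simp add: tie_key_def algebra_simps)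
qed

lemma tie_key_remove_less:
  assumes X: "X \<in> nsets {1..n} d" and ab: "a \<in> X" "b \<in> X" "a < b"
  shows "\<Sum>X < s \<or> \<Sum>X = s \<and> X \<in> \<A> \<Longrightarrow> tie_key n s \<A> (X - {a}) < tie_key n s \<A> (X - {b})"
    and "\<Sum>X > s \<or> \<Sum>X = s \<and> X \<notin> \<A> \<Longrightarrow> tie_key n s \<A> (X - {b}) < tie_key n s \<A> (X - {a})"
proof -
  have fin: "finite X" using X by (auto simp: nsets_def)
  note diff = height_diff[OF fin ab(1,2), of s]
  have tie: "tie_key n s \<A> (X - {b}) - tie_key n s \<A> (X - {a}) =
      (if X \<in> \<A> then int b - int a else int a - int b)" if "\<Sum>X = s"
    using that diff tie_break_remove[of X n d s] X ab(1,2)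
    by (simp add: tie_key_def sum_layer_def)
  have less: "height s (X - {a}) < height s (X - {b})" if "\<Sum>X < s"
  proof -
    have "2 * (int b - int a) * (int (\<Sum>X) - int s) < 0"
      using that ab(3) by (intro mult_pos_neg) (simp_all del: of_nat_sum)
    with diff show ?thesis by linarith
  qed
  have greater: "height s (X - {b}) < height s (X - {a})" if "\<Sum>X > s"
  proof -
    have "2 * (int b - int a) * (int (\<Sum>X) - int s) > 0"
      using that ab(3) by (intro mult_pos_pos) (simp_all del: of_nat_sum)
    with diff show ?thesis by linarith
  qed
  show "tie_key n s \<A> (X - {a}) < tie_key n s \<A> (X - {b})" if "\<Sum>X < s \<or> \<Sum>X = s \<and> X \<in> \<A>"
    using that less[THEN tie_key_less] tie ab(3) by auto
  show "tie_key n s \<A> (X - {b}) < tie_key n s \<A> (X - {a})" if "\<Sum>X > s \<or> \<Sum>X = s \<and> X \<notin> \<A>"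
    using that greater[THEN tie_key_less] tie ab(3) by auto
qed

text \<open>Sort all \<open>k\<close>-sets by \<open>tie_key\<close>. Distinct members of a packet
  have distinct keys, so the remaining ties never affect a packet.\<close>

lemma exists_admissible_with_inversions:
  assumes "\<A> \<subseteq> sum_layer n (k + 1) s" "k \<ge> 1"
  obtains \<rho> where "\<rho> \<in> admissible_orders n k" "inversions n k \<rho> \<inter> sum_layer n (k + 1) s = \<A>"
proof -
  obtain xs where xs: "set xs = nsets {1..n} k" "distinct xs"
    using finite_distinct_list finite_imp_finite_nsets[of "{1..n}" k] by auto
  define \<rho> where "\<rho> = sort_key (tie_key n s \<A>) xs"
  have prec: "precedes \<rho> (X - {a}) (X - {b})"
    if "X \<in> nsets {1..n} (k + 1)" "a \<in> X" "b \<in> X"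
      "tie_key n s \<A> (X - {a}) < tie_key n s \<A> (X - {b})" for X a b
    unfolding \<rho>_def using that xs(1) remove_in_nsets[OF that(1)] by (intro precedes_sort_key) simp_all
  have antilex: "antilex_on_packet \<rho> X"
    if "X \<in> nsets {1..n} (k + 1)" "\<Sum>X < s \<or> \<Sum>X = s \<and> X \<in> \<A>" for X
    unfolding antilex_on_packet_def
    using prec[OF that(1)] tie_key_remove_less(1)[OF that(1) _ _ _ that(2)] by simp
  have lex: "lex_on_packet \<rho> X"
    if "X \<in> nsets {1..n} (k + 1)" "\<Sum>X > s \<or> \<Sum>X = s \<and> X \<notin> \<A>" for X
    unfolding lex_on_packet_def
    using prec[OF that(1)] tie_key_remove_less(2)[OF that(1) _ _ _ that(2)] by simp
  have "lex_on_packet \<rho> X \<or> antilex_on_packet \<rho> X" if "X \<in> nsets {1..n} (k + 1)" for X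
    using lex[OF that] antilex[OF that] by (meson linorder_neqE_nat)
  then have adm: "\<rho> \<in> admissible_orders n k"
    using xs by (simp add: admissible_orders_iff \<rho>_def)
  have "X \<in> inversions n k \<rho> \<longleftrightarrow> X \<in> \<A>" if X: "X \<in> sum_layer n (k + 1) s" for X
  proof
    assume inv: "X \<in> inversions n k \<rho>"
    show "X \<in> \<A>"
    proof (rule ccontr)
      assume "X \<notin> \<A>"
      have X': "X \<in> nsets {1..n} (k + 1)" "\<Sum>X = s" using X by (auto simp: sum_layer_def)
      obtain a b where ab: "a \<in> X" "b \<in> X" "a < b" using nsets_two_elements X'(1) assms(2) .
      have "precedes \<rho> (X - {b}) (X - {a})"
        using lex[OF X'(1)] X'(2) \<open>X \<notin> \<A>\<close> ab by (simp add: lex_on_packet_def)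
      moreover have "precedes \<rho> (X - {a}) (X - {b})"
        using inv ab by (simp add: inversions_def antilex_on_packet_def)
      ultimately show False
        using adm precedes_asym[of \<rho> "X - {a}" "X - {b}"] by (simp add: admissible_orders_iff)
    qed
  next
    assume "X \<in> \<A>"
    with X show "X \<in> inversions n k \<rho>"
      using antilex by (simp add: inversions_def sum_layer_def)
  qed
  with assms(1) have "inversions n k \<rho> \<inter> sum_layer n (k + 1) s = \<A>" by blast
  with adm show ?thesis by (rule that)
qed

text \<open>Intersection with the layer maps the inversion sets onto all subsets of the
  layer.\<close>

lemma card_inversions_ge:
  assumes "k \<ge> 1"
  shows "2 ^ card (sum_layer n (k + 1) s) \<le> card (inversions n k ` admissible_orders n k)"
proof -
  let ?L = "sum_layer n (k + 1) s"
  have fin: "finite ?L"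
    by (simp add: sum_layer_def finite_imp_finite_nsets)
  have "Pow ?L \<subseteq> (\<lambda>S. S \<inter> ?L) ` inversions n k ` admissible_orders n k"
  proof
    fix \<A> assume "\<A> \<in> Pow ?L"
    then obtain \<rho> where "\<rho> \<in> admissible_orders n k" "inversions n k \<rho> \<inter> ?L = \<A>"
      using exists_admissible_with_inversions assms by blast
    then show "\<A> \<in> (\<lambda>S. S \<inter> ?L) ` inversions n k ` admissible_orders n k" by blast
  qed
  then have "card (Pow ?L) \<le> card (inversions n k ` admissible_orders n k)"
    by (intro surj_card_le) (auto simp: finite_admissible_orders)
  then show ?thesis unfolding card_Pow[OF fin] .
qed

section \<open>Large layers of constant sum\<close>

lemma card_nsets:
  assumes "finite V"
  shows "card (nsets V d) = card V choose d"
proof -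
  have "nsets V d = {N. N \<subseteq> V \<and> card N = d}"
    using assms finite_subset by (auto simp: nsets_def)
  then show ?thesis using n_subsets[OF assms] by simp
qed

lemma card_nsets_superset:
  assumes "finite V" "S \<subseteq> V" "card S \<le> d"
  shows "card {X \<in> nsets V d. S \<subseteq> X} = (card V - card S) choose (d - card S)"
proof -
  have fin: "finite S" using assms finite_subset by blast
  have "bij_betw (\<lambda>Y. Y \<union> S) (nsets (V - S) (d - card S)) {X \<in> nsets V d. S \<subseteq> X}"
  proof (rule bij_betw_byWitness[where f' = "\<lambda>X. X - S"])
    show "(\<lambda>Y. Y \<union> S) ` nsets (V - S) (d - card S) \<subseteq> {X \<in> nsets V d. S \<subseteq> X}"
    proof clarify
      fix Y assume "Y \<in> nsets (V - S) (d - card S)"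
      then have "finite Y" "Y \<subseteq> V" "card Y = d - card S" "Y \<inter> S = {}"
        by (auto simp: nsets_def)
      then show "Y \<union> S \<in> nsets V d \<and> S \<subseteq> Y \<union> S"
        using assms fin by (auto simp: nsets_def card_Un_disjoint)
    qed
    show "(\<lambda>X. X - S) ` {X \<in> nsets V d. S \<subseteq> X} \<subseteq> nsets (V - S) (d - card S)"
      using fin by (auto simp: nsets_def card_Diff_subset)
  qed (auto simp: nsets_def)
  from bij_betw_same_card[OF this] show ?thesis
    using assms fin by (simp add: card_nsets card_Diff_subset)
qed

text \<open>Expand the square and count the sets containing \<open>x\<close> and \<open>z\<close>:
  \<open>A\<close> if \<open>x = z\<close>, otherwise \<open>B\<close>. As the values sum to zero, a
  constant weight \<open>B\<close> contributes nothing, leaving the factor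
  \<open>A - B \<le> A\<close>. This is the variance bound for sampling without replacement.\<close>

lemma second_moment_nsets_le:
  fixes y :: "'a \<Rightarrow> real"
  assumes "finite V" "(\<Sum>x\<in>V. y x) = 0" "d \<ge> 2"
  shows "(\<Sum>X\<in>nsets V d. (\<Sum>x\<in>X. y x)\<^sup>2) \<le>
    real ((card V - 1) choose (d - 1)) * (\<Sum>x\<in>V. (y x)\<^sup>2)"
proof -
  define A where "A = real ((card V - 1) choose (d - 1))"
  define B where "B = real ((card V - 2) choose (d - 2))"
  have fin: "finite (nsets V d)" using assms(1) by (rule finite_imp_finite_nsets)
  have square: "(\<Sum>x\<in>X. y x)\<^sup>2 = (\<Sum>x\<in>V. \<Sum>z\<in>V. if {x, z} \<subseteq> X then y x * y z else 0)"
    if "X \<in> nsets V d" for X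
  proof -
    have X: "X \<subseteq> V" using that by (auto simp: nsets_def)
    have sub: "(\<Sum>x\<in>X. g x) = (\<Sum>x\<in>V. if x \<in> X then g x else 0)" for g :: "'a \<Rightarrow> real"
      using X assms(1) by (simp add: sum.inter_restrict[symmetric] Int_absorb1)
    show ?thesis
      unfolding power2_eq_square sum_product sub by (intro sum.cong refl) auto
  qed
  have count: "(\<Sum>X\<in>nsets V d. if {x, z} \<subseteq> X then y x * y z else 0) =
      (if x = z then A else B) * (y x * y z)" if "x \<in> V" "z \<in> V" for x z
  proof -
    have "(\<Sum>X\<in>nsets V d. if {x, z} \<subseteq> X then y x * y z else 0) =
        real (card {X \<in> nsets V d. {x, z} \<subseteq> X}) * (y x * y z)"
      using fin by (simp flip: sum.inter_filter)
    also have "card {X \<in> nsets V d. {x, z} \<subseteq> X} = (card V - card {x, z}) choose (d - card {x, z})"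
      using that assms by (intro card_nsets_superset) (auto simp: card_insert_if)
    finally show ?thesis by (auto simp: A_def B_def numeral_2_eq_2)
  qed
  have "(\<Sum>X\<in>nsets V d. (\<Sum>x\<in>X. y x)\<^sup>2) =
      (\<Sum>X\<in>nsets V d. \<Sum>x\<in>V. \<Sum>z\<in>V. if {x, z} \<subseteq> X then y x * y z else 0)"
    by (intro sum.cong refl square)
  also have "\<dots> = (\<Sum>x\<in>V. \<Sum>z\<in>V. \<Sum>X\<in>nsets V d. if {x, z} \<subseteq> X then y x * y z else 0)"
    by (subst sum.swap) (intro sum.cong refl sum.swap)
  also have "\<dots> = (\<Sum>x\<in>V. \<Sum>z\<in>V. (if x = z then A else B) * (y x * y z))"
    by (intro sum.cong refl count)
  also have "\<dots> = (\<Sum>x\<in>V. (A - B) * (y x)\<^sup>2)"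
  proof (intro sum.cong refl)
    fix x assume "x \<in> V"
    have "(\<Sum>z\<in>V. (if x = z then A else B) * (y x * y z)) =
        (\<Sum>z\<in>V. B * y x * y z + (if z = x then (A - B) * (y x)\<^sup>2 else 0))"
      by (intro sum.cong refl) (auto simp: algebra_simps power2_eq_square)
    also have "\<dots> = B * y x * (\<Sum>z\<in>V. y z) + (A - B) * (y x)\<^sup>2"
      using \<open>x \<in> V\<close> assms(1) by (simp add: sum.distrib sum_distrib_left)
    finally show "(\<Sum>z\<in>V. (if x = z then A else B) * (y x * y z)) = (A - B) * (y x)\<^sup>2"
      using assms(2) by simp
  qed
  also have "\<dots> \<le> (\<Sum>x\<in>V. A * (y x)\<^sup>2)"
    by (intro sum_mono mult_right_mono) (auto simp: B_def)
  finally show ?thesis by (simp add: A_def sum_distrib_left)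
qed

lemma sum_centered_squares:
  "(\<Sum>x = 1..n. (2 * real x - real (n + 1))\<^sup>2) = real n * ((real n)\<^sup>2 - 1) / 3"
proof -
  have squares: "(\<Sum>x = 1..n. (real x)\<^sup>2) = real n * (real n + 1) * (2 * real n + 1) / 6"
    by (induction n) (simp_all add: field_simps power2_eq_square)
  have gauss: "(\<Sum>x = 1..n. real x) = real n * (real n + 1) / 2"
    by (induction n) (simp_all add: field_simps)
  have "(\<Sum>x = 1..n. (2 * real x - real (n + 1))\<^sup>2) =
      (\<Sum>x = 1..n. 4 * (real x)\<^sup>2 - 4 * (real n + 1) * real x + (real n + 1)\<^sup>2)"
    by (intro sum.cong refl) (simp add: power2_eq_square algebra_simps)
  also have "\<dots> = 4 * (\<Sum>x = 1..n. (real x)\<^sup>2) - 4 * (real n + 1) * (\<Sum>x = 1..n. real x)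
      + real n * (real n + 1)\<^sup>2"
    by (simp add: sum.distrib sum_subtractf sum_distrib_left)
  also have "\<dots> = real n * ((real n)\<^sup>2 - 1) / 3"
    unfolding squares gauss by (simp add: power2_eq_square field_simps)
  finally show ?thesis .
qed

lemma second_moment_sums_le:
  assumes "d \<ge> 2"
  shows "(\<Sum>X\<in>nsets {1..n} d. (2 * real (\<Sum>X) - real d * real (n + 1))\<^sup>2) \<le>
    real (n choose d) * real d * (real n)\<^sup>2 / 3"
proof -
  \<comment> \<open>Doubling and centering: these values sum to 0 over \<open>{1..n}\<close>, and
    over \<open>X\<close> they sum to the term being squared.\<close>
  define y where "y x = 2 * real x - real (n + 1)" for x
  have "(\<Sum>x = 1..n. real x) = real n * (real n + 1) / 2"
    by (induction n) (simp_all add: field_simps)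
  moreover have "(\<Sum>x = 1..n. y x) = 2 * (\<Sum>x = 1..n. real x) - real n * (real n + 1)"
    by (simp add: y_def sum_subtractf sum_distrib_left)
  ultimately have centered: "(\<Sum>x = 1..n. y x) = 0" by simp
  have "(\<Sum>X\<in>nsets {1..n} d. (2 * real (\<Sum>X) - real d * real (n + 1))\<^sup>2) =
      (\<Sum>X\<in>nsets {1..n} d. (\<Sum>x\<in>X. y x)\<^sup>2)"
    by (intro sum.cong refl) (auto simp: nsets_def y_def sum_subtractf sum_distrib_left)
  also have "\<dots> \<le> real ((n - 1) choose (d - 1)) * (\<Sum>x\<in>{1..n}. (y x)\<^sup>2)"
    using second_moment_nsets_le[OF _ centered assms] by simp
  also have "\<dots> = (real n * real ((n - 1) choose (d - 1))) * ((real n)\<^sup>2 - 1) / 3"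
    using sum_centered_squares[of n] by (simp add: y_def)
  also have "real n * real ((n - 1) choose (d - 1)) = real d * real (n choose d)"
    using binomial_absorption[of "d - 1" n] assms by (simp flip: of_nat_mult)
  also have "real d * real (n choose d) * ((real n)\<^sup>2 - 1) / 3 \<le>
      real d * real (n choose d) * (real n)\<^sup>2 / 3"
    by (intro divide_right_mono mult_left_mono) auto
  finally show ?thesis by (simp add: mult.commute)
qed

text \<open>The numbers \<open>s\<close> lie in an interval of length \<open>r\<close>.\<close>

lemma card_nat_near_le:
  fixes c r :: real
  assumes "r \<ge> 0"
  shows "finite {s :: nat. \<bar>2 * real s - c\<bar> \<le> r}"
    and "real (card {s :: nat. \<bar>2 * real s - c\<bar> \<le> r}) \<le> r + 1"
proof -
  let ?S = "{s :: nat. \<bar>2 * real s - c\<bar> \<le> r}"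
  let ?I = "{\<lceil>(c - r) / 2\<rceil>..\<lfloor>(c + r) / 2\<rfloor>}"
  have sub: "int ` ?S \<subseteq> ?I"
    by (auto simp: ceiling_le_iff le_floor_iff abs_le_iff)
  then have "finite (int ` ?S)" by (rule finite_subset) simp
  then show "finite ?S" by (rule finite_imageD) simp
  have "card ?S = card (int ` ?S)" by (simp add: card_image)
  also have "\<dots> \<le> card ?I" using sub by (intro card_mono) auto
  also have "\<dots> = nat (\<lfloor>(c + r) / 2\<rfloor> - \<lceil>(c - r) / 2\<rceil> + 1)" by simp
  finally have "real (card ?S) \<le> real (nat (\<lfloor>(c + r) / 2\<rfloor> - \<lceil>(c - r) / 2\<rceil> + 1))"
    by (simp only: of_nat_le_iff)
  also have "\<dots> \<le> r + 1"
  proof (cases "\<lfloor>(c + r) / 2\<rfloor> - \<lceil>(c - r) / 2\<rceil> + 1 \<ge> 0")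
    case True
    then have eq: "real (nat (\<lfloor>(c + r) / 2\<rfloor> - \<lceil>(c - r) / 2\<rceil> + 1)) =
        real_of_int \<lfloor>(c + r) / 2\<rfloor> - real_of_int \<lceil>(c - r) / 2\<rceil> + 1" by simp
    have "x - y + 1 \<le> r + 1" if "x \<le> (c + r) / 2" "(c - r) / 2 \<le> y" for x y
      using that by (simp add: field_simps)
    from this[OF of_int_floor_le le_of_int_ceiling] show ?thesis unfolding eq .
  qed (use assms in auto)
  finally show "real (card ?S) \<le> r + 1" .
qed

lemma exists_large_sum_layer:
  assumes "d \<ge> 2" "n \<ge> d"
  obtains s where
    "3 / 4 * real (n choose d) \<le> real (card (sum_layer n d s)) * (2 * real n * sqrt (real d / 3) + 1)"
proof -
  \<comment> \<open>The square of \<open>r\<close> is four times the bound on the mean square of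
    \<open>t\<close>, so by Chebyshev at most a quarter of the sets satisfy
    \<open>\<bar>t X\<bar> > r\<close>.\<close>
  define r where "r = 2 * real n * sqrt (real d / 3)"
  define t where "t X = 2 * real (\<Sum>X) - real d * real (n + 1)" for X :: "nat set"
  define N where "N = nsets {1..n} d"
  define S where "S = {s :: nat. \<bar>2 * real s - real d * real (n + 1)\<bar> \<le> r}"
  have r: "r > 0" "r\<^sup>2 = 4 * (real n)\<^sup>2 * real d / 3"
    using assms by (auto simp: r_def power_mult_distrib)
  have fin: "finite N" by (simp add: N_def finite_imp_finite_nsets)
  have cardN: "card N = n choose d" by (simp add: N_def card_nsets)
  have "real (card {X \<in> N. \<bar>t X\<bar> > r}) * r\<^sup>2 = (\<Sum>X\<in>{X \<in> N. \<bar>t X\<bar> > r}. r\<^sup>2)"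
    by simp
  also have "\<dots> \<le> (\<Sum>X\<in>{X \<in> N. \<bar>t X\<bar> > r}. (t X)\<^sup>2)"
    using r(1) by (intro sum_mono) (auto simp flip: abs_le_square_iff)
  also have "\<dots> \<le> (\<Sum>X\<in>N. (t X)\<^sup>2)"
    using fin by (intro sum_mono2) auto
  also have "\<dots> \<le> real (n choose d) * real d * (real n)\<^sup>2 / 3"
    unfolding N_def t_def by (rule second_moment_sums_le[OF assms(1)])
  also have "\<dots> = real (n choose d) / 4 * r\<^sup>2"
    by (simp add: r(2))
  finally have far: "real (card {X \<in> N. \<bar>t X\<bar> > r}) \<le> real (n choose d) / 4"
    using r(1) by simp
  have "card N = card {X \<in> N. \<bar>t X\<bar> > r} + card {X \<in> N. \<not> \<bar>t X\<bar> > r}"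
    using fin by (subst card_Un_disjoint[symmetric]) (auto intro: arg_cong[where f = card])
  with far cardN have near: "3 / 4 * real (n choose d) \<le> real (card {X \<in> N. \<not> \<bar>t X\<bar> > r})"
    by simp
  have S: "finite S" "real (card S) \<le> r + 1"
    unfolding S_def using card_nat_near_le[of r] r(1) by auto
  have "{X \<in> N. \<not> \<bar>t X\<bar> > r} \<subseteq> (\<Union>s\<in>S. sum_layer n d s)"
    by (auto simp: sum_layer_def S_def N_def t_def)
  then have "card {X \<in> N. \<not> \<bar>t X\<bar> > r} \<le> card (\<Union>s\<in>S. sum_layer n d s)"
    using S(1) by (intro card_mono) (auto simp: sum_layer_def finite_imp_finite_nsets)
  also have "\<dots> \<le> (\<Sum>s\<in>S. card (sum_layer n d s))"
    using S(1) by (rule card_UN_le)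
  finally have "real (card {X \<in> N. \<not> \<bar>t X\<bar> > r}) \<le> (\<Sum>s\<in>S. real (card (sum_layer n d s)))"
    unfolding of_nat_sum[symmetric] of_nat_le_iff .
  with near have layers: "3 / 4 * real (n choose d) \<le> (\<Sum>s\<in>S. real (card (sum_layer n d s)))"
    by linarith
  have "n choose d > 0" using assms by simp
  then have "S \<noteq> {}" using layers by auto
  \<comment> \<open>Pigeonhole: three quarters of all sets are spread over at most
    \<open>r + 1\<close> sums.\<close>
  have "\<exists>s. 3 / 4 * real (n choose d) \<le> real (card (sum_layer n d s)) * (r + 1)"
  proof (rule ccontr)
    assume "\<nexists>s. 3 / 4 * real (n choose d) \<le> real (card (sum_layer n d s)) * (r + 1)"
    then have "(\<Sum>s\<in>S. real (card (sum_layer n d s)) * (r + 1)) < (\<Sum>s\<in>S. 3 / 4 * real (n choose d))"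
      using S(1) \<open>S \<noteq> {}\<close> by (intro sum_strict_mono) (auto simp: not_le)
    also have "\<dots> = 3 / 4 * real (n choose d) * real (card S)" by simp
    also have "\<dots> \<le> 3 / 4 * real (n choose d) * (r + 1)"
      using S(2) by (intro mult_left_mono) auto
    finally have "(\<Sum>s\<in>S. real (card (sum_layer n d s))) * (r + 1) < 3 / 4 * real (n choose d) * (r + 1)"
      unfolding sum_distrib_right .
    then show False using layers r(1) by (simp add: mult_less_cancel_right_pos)
  qed
  then show ?thesis using that unfolding r_def by blast
qed

section \<open>Explicit constants for the lower bound\<close>

lemma binomial_fact_ge:
  assumes "n \<ge> d"
  shows "(real n - real d) ^ d \<le> fact d * real (n choose d)"
proof -
  have "(real n - real d) ^ d = (\<Prod>i = 0..<d. real n - real d)" by simp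
  also have "\<dots> \<le> (\<Prod>i = 0..<d. real n - real i)"
    using assms by (intro prod_mono) auto
  also have "\<dots> = fact d * real (n choose d)"
    by (simp add: binomial_gbinomial gbinomial_prod_rev)
  finally show ?thesis .
qed

text \<open>By Bernoulli's inequality \<open>(1 - d / n) ^ d\<close> is at least
  \<open>1 - d\<^sup>2 / n\<close>, and the assumption on \<open>n\<close> makes this at least
  \<open>1 / 2\<close>.\<close>

lemma power_le_binomial_fact:
  assumes "d \<ge> 1" "n \<ge> 2 * d\<^sup>2"
  shows "real n ^ d / 2 \<le> fact d * real (n choose d)"
proof -
  have "d \<le> d\<^sup>2" by (simp add: power2_eq_square)
  then have "n \<ge> d" "n > 0" using assms by linarith+
  have "1 / 2 \<le> 1 - real d * (real d / real n)"
  proof -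
    have "2 * (real d)\<^sup>2 \<le> real n" using assms(2) by (metis of_nat_le_iff of_nat_mult of_nat_numeral of_nat_power)
    then show ?thesis using \<open>n > 0\<close> by (simp add: field_simps power2_eq_square)
  qed
  also have "\<dots> \<le> (1 - real d / real n) ^ d"
    using Bernoulli_inequality[of "- (real d / real n)" d] \<open>n \<ge> d\<close> \<open>n > 0\<close> by simp
  finally have "real n ^ d * (1 / 2) \<le> real n ^ d * (1 - real d / real n) ^ d"
    by (intro mult_left_mono) auto
  also have "\<dots> = (real n - real d) ^ d"
    using \<open>n > 0\<close> by (simp add: field_simps flip: power_mult_distrib)
  also have "\<dots> \<le> fact d * real (n choose d)" using \<open>n \<ge> d\<close> by (rule binomial_fact_ge)
  finally show ?thesis by simp
qed

lemma exists_sum_layer_ge: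
  assumes "k \<ge> 2" "n \<ge> 2 * (k + 1)\<^sup>2"
  obtains s where
    "real n ^ k / (fact (k + 1) * sqrt (24 * pi * real k)) \<le> real (card (sum_layer n (k + 1) s))"
proof -
  define d where "d = k + 1"
  have "d \<le> d\<^sup>2" by (simp add: power2_eq_square)
  then have d: "d \<ge> 2" "n \<ge> d" "n \<ge> 1" using assms unfolding d_def by linarith+
  obtain s where s:
    "3 / 4 * real (n choose d) \<le> real (card (sum_layer n d s)) * (2 * real n * sqrt (real d / 3) + 1)"
    using exists_large_sum_layer[OF d(1,2)] .
  define L where "L = real (card (sum_layer n d s))"
  define q where "q = sqrt (real d / 3)"
  \<comment> \<open>Here \<open>d \<ge> 3\<close>; the summand 1 in the number of sums is thus
    absorbed into \<open>real n * q\<close>.\<close>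
  have "q \<ge> 1" using assms(1) by (simp add: d_def q_def)
  then have "1 * 1 \<le> real n * q" using d by (intro mult_mono) auto
  then have "L * (2 * real n * q + 1) \<le> L * (3 * (real n * q))"
    by (intro mult_left_mono) (auto simp: L_def mult.commute)
  with s have "real (n choose d) \<le> 4 * L * real n * q"
    by (simp add: L_def q_def)
  then have "fact d * real (n choose d) \<le> fact d * (4 * L * real n * q)"
    by (intro mult_left_mono) auto
  moreover have "real n ^ d / 2 \<le> fact d * real (n choose d)"
    using assms(2) by (intro power_le_binomial_fact) (auto simp: d_def)
  moreover have "real n ^ d = real n * real n ^ k" by (simp add: d_def)
  ultimately have "real n * real n ^ k \<le> 2 * (fact d * (4 * L * real n * q))" by linarith
  also have "\<dots> = real n * (fact d * L * (8 * q))" by simp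
  finally have "real n ^ k \<le> fact d * L * (8 * q)"
    using d(3) by simp
  also have "8 * q = sqrt (64 * (real d / 3))"
    unfolding real_sqrt_mult q_def by simp
  also have "\<dots> \<le> sqrt (24 * pi * real k)"
  \<comment> \<open>There is slack: \<open>64 * (k + 1) / 3 \<le> 48 * k\<close> holds for
    \<open>k \<ge> 2\<close>, and \<open>pi \<ge> 2\<close> gives the rest.\<close>
  proof (rule real_sqrt_le_mono)
    have "64 * (real d / 3) \<le> 24 * 2 * real k" using assms(1) by (simp add: d_def)
    also have "\<dots> \<le> 24 * pi * real k" using pi_ge_two by (intro mult_right_mono) auto
    finally show "64 * (real d / 3) \<le> 24 * pi * real k" .
  qed
  finally have "real n ^ k \<le> fact d * L * sqrt (24 * pi * real k)"
    by (simp add: L_def mult_left_mono)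
  moreover have "fact d * sqrt (24 * pi * real k) > 0" using assms(1) by simp
  ultimately have "real n ^ k / (fact d * sqrt (24 * pi * real k)) \<le> L"
    by (simp add: pos_divide_le_eq mult.commute mult.left_commute)
  then show ?thesis using that unfolding L_def d_def by blast
qed

section \<open>Asymptotic bounds\<close>

text \<open>
  The quotient of consecutive products of binomial rows is \<open>m\<^sup>m / m! \<le> exp m\<close>.
\<close>

lemma prod_binomial_row_le: "real (\<Prod>j\<le>m. m choose j) \<le> exp (real (Suc m choose 2))"
proof (induction m)
  case (Suc m)
  have row: "real (\<Prod>j\<le>Suc m. Suc m choose j) =
      real (\<Prod>j\<le>m. m choose j) * (real (Suc m) ^ Suc m / fact (Suc m))"
  proof -
    \<comment> \<open>The numerators multiply to \<open>Suc m ^ Suc m\<close> and the denominators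
      to \<open>fact (Suc m)\<close>.\<close>
    have choose: "real (Suc m choose j) = real (m choose j) * (real (Suc m) / real (Suc m - j))"
      if "j \<le> m" for j
    proof -
      have "(Suc m choose j) * (Suc m - j) = Suc m * (m choose j)"
        using that binomial_absorb_comp[of "Suc m" j] by (simp add: mult.commute)
      then have "real (Suc m choose j) * real (Suc m - j) = real (Suc m) * real (m choose j)"
        by (metis of_nat_mult)
      then show ?thesis using that by (simp add: field_simps)
    qed
    have "(\<Prod>j\<le>m. real (Suc m - j)) = fact (Suc m)"
    proof -
      have "(\<Prod>j\<le>m. real (Suc m - j)) = (\<Prod>j = 0..<Suc m. real (Suc m - j))"
        by (intro prod.cong) auto
      also have "\<dots> = fact (Suc m)"
        unfolding fact_prod_rev[of "Suc m"] by simp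
      finally show ?thesis .
    qed
    moreover have "real (\<Prod>j\<le>Suc m. Suc m choose j) = (\<Prod>j\<le>m. real (Suc m choose j))"
      by simp
    ultimately show ?thesis
      by (simp add: choose prod.distrib prod_dividef)
  qed
  have "real (Suc m) ^ Suc m / fact (Suc m) \<le> exp (real (Suc m))"
  proof -
    \<comment> \<open>A single term of the exponential series is bounded by the whole
      series.\<close>
    have "(\<Sum>i\<in>{Suc m}. inverse (fact i) * real (Suc m) ^ i) \<le> (\<Sum>i. inverse (fact i) * real (Suc m) ^ i)"
      using summable_exp[of "real (Suc m)"] by (intro sum_le_suminf) auto
    then show ?thesis by (simp add: exp_def divide_inverse mult.commute scaleR_conv_of_real)
  qed
  then have "real (\<Prod>j\<le>Suc m. Suc m choose j) \<le> exp (real (Suc m choose 2)) * exp (real (Suc m))"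
    unfolding row using Suc.IH by (intro mult_mono) auto
  also have "\<dots> = exp (real (Suc (Suc m) choose 2))"
    by (simp add: numeral_2_eq_2 flip: exp_add)
  finally show ?case .
qed (simp add: numeral_2_eq_2)

lemma card_inversions_0_le:
  assumes "k \<ge> 1"
  shows "real (card (inversions 0 k ` admissible_orders 0 k)) \<le> exp (real (0 choose k))"
proof -
  have "nsets {1..0::nat} k = {}" using assms by (simp add: nsets_eq_empty)
  then have "admissible_orders 0 k \<subseteq> {[]}" by (auto simp: admissible_orders_iff)
  then have "inversions 0 k ` admissible_orders 0 k \<subseteq> {inversions 0 k []}"
    by blast
  from card_mono[OF _ this] have "real (card (inversions 0 k ` admissible_orders 0 k)) \<le> 1"
    by simp
  also have "1 \<le> exp (real (0 choose k))" by simp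
  finally show ?thesis .
qed

text \<open>Induction on \<open>k\<close> and, for each \<open>k > 2\<close>, on \<open>n\<close>.
  Splitting off \<open>Suc n\<close> multiplies the bounds, and Pascal's rule adds up the
  exponents.\<close>

lemma card_inversions_le_exp:
  assumes "k \<ge> 2"
  shows "real (card (inversions n k ` admissible_orders n k)) \<le> exp (real (n choose k))"
  using assms
proof (induction k arbitrary: n rule: dec_induct)
  case base
  show ?case
  proof (cases n)
    case 0
    then show ?thesis using card_inversions_0_le by simp
  next
    case (Suc m)
    have "(\<Prod>i = 1..n. (n - 1) choose (i - 1)) = (\<Prod>j\<le>m. m choose j)"
      unfolding Suc by (rule prod.reindex_bij_witness[of _ Suc "\<lambda>i. i - 1"]) auto
    then have "real (card (inversions n 2 ` admissible_orders n 2)) \<le> real (\<Prod>j\<le>m. m choose j)"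
      using card_inversions_2_le[of n] by (simp only: of_nat_le_iff)
    also have "\<dots> \<le> exp (real (n choose 2))"
      unfolding Suc by (rule prod_binomial_row_le)
    finally show ?thesis .
  qed
next
  case (step k)
  show ?case
  proof (induction n)
    case 0
    show ?case by (rule card_inversions_0_le) simp
  next
    case (Suc n)
    have "real (card (inversions (Suc n) (Suc k) ` admissible_orders (Suc n) (Suc k))) \<le>
        real (card (inversions n (Suc k) ` admissible_orders n (Suc k)) *
          card (inversions n k ` admissible_orders n k))"
      using card_inversions_Suc_le[of k n] step.hyps by (simp only: of_nat_le_iff)
    also have "\<dots> \<le> exp (real (n choose Suc k)) * exp (real (n choose k))"
      unfolding of_nat_mult using Suc step.IH[of n] by (intro mult_mono) auto
    also have "\<dots> = exp (real (Suc n choose Suc k))"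
      by (simp add: add.commute flip: exp_add)
    finally show ?case .
  qed
qed

theorem theorem2:
  shows "\<exists>c :: nat \<Rightarrow> real.
    (\<forall>k\<ge>2. \<forall>\<^sub>F n in sequentially.
        c k * real n ^ k / (fact k * fact (k + 1)) \<le> log 2 (real (card (higher_bruhat n k))) \<and>
        log 2 (real (card (higher_bruhat n k))) \<le> real n ^ k / (fact k * ln 2)) \<and>
    (\<lambda>k. c k / (fact k / sqrt (24 * pi * real k))) \<longlonglongrightarrow> 1"
proof (intro exI conjI allI impI)
  let ?c = "\<lambda>k. fact k / sqrt (24 * pi * real k) :: real"
  show "(\<lambda>k. ?c k / (fact k / sqrt (24 * pi * real k))) \<longlonglongrightarrow> 1"
  proof (rule tendsto_eventually)
    \<comment> \<open>The quotient is exactly 1 except at \<open>k = 0\<close>, where division by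
      zero gives 0.\<close>
    show "\<forall>\<^sub>F k in sequentially. ?c k / (fact k / sqrt (24 * pi * real k)) = 1"
      using eventually_gt_at_top[of 0] by eventually_elim auto
  qed
  fix k :: nat assume k: "k \<ge> 2"
  show "\<forall>\<^sub>F n in sequentially.
        ?c k * real n ^ k / (fact k * fact (k + 1)) \<le> log 2 (real (card (higher_bruhat n k))) \<and>
        log 2 (real (card (higher_bruhat n k))) \<le> real n ^ k / (fact k * ln 2)"
    \<comment> \<open>This threshold for \<open>n\<close> is the hypothesis of
      \<open>exists_sum_layer_ge\<close>.\<close>
    using eventually_ge_at_top[of "2 * (k + 1)\<^sup>2"]
  proof eventually_elim
    case (elim n)
    define b where "b = card (inversions n k ` admissible_orders n k)"
    have b: "card (higher_bruhat n k) = b"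
      using k by (simp add: b_def card_higher_bruhat)
    obtain s where s:
      "real n ^ k / (fact (k + 1) * sqrt (24 * pi * real k)) \<le> real (card (sum_layer n (k + 1) s))"
      using exists_sum_layer_ge[OF k elim] .
    define N where "N = card (sum_layer n (k + 1) s)"
    have "2 ^ N \<le> b" unfolding N_def b_def using k by (intro card_inversions_ge) simp
    then have "2 ^ N \<le> real b" by (metis of_nat_le_iff of_nat_numeral of_nat_power)
    then have b_pos: "real b > 0" by (rule less_le_trans[rotated]) simp
    have "log 2 (2 ^ N) \<le> log 2 (real b)"
      using \<open>2 ^ N \<le> real b\<close> b_pos by (subst log_le_cancel_iff) simp_all
    then have "real N \<le> log 2 (real b)" by (simp add: log_nat_power)
    have "x / q * a / (x * f) = a / (f * q)" if "x \<noteq> 0" for x q a f :: real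
      using that by simp
    from this[OF fact_nonzero] have "?c k * real n ^ k / (fact k * fact (k + 1)) =
        real n ^ k / (fact (k + 1) * sqrt (24 * pi * real k))" .
    with s have "?c k * real n ^ k / (fact k * fact (k + 1)) \<le> real N"
      unfolding N_def by (simp only:)
    with \<open>real N \<le> log 2 (real b)\<close>
    have lower: "?c k * real n ^ k / (fact k * fact (k + 1)) \<le> log 2 (real b)"
      by (rule order_trans[rotated])
    have "ln (real b) \<le> ln (exp (real (n choose k)))"
      using card_inversions_le_exp[OF k, of n, folded b_def] b_pos
      by (subst ln_le_cancel_iff) simp_all
    also have "\<dots> \<le> real n ^ k / fact k"
    proof -
      have "real ((n choose k) * fact k) \<le> real (n ^ k)"
        unfolding of_nat_le_iff by (rule binomial_fact_pow)
      then show ?thesis by (simp add: field_simps)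
    qed
    finally have "log 2 (real b) \<le> real n ^ k / (fact k * ln 2)"
      by (simp add: log_def divide_right_mono flip: divide_divide_eq_left)
    with lower show ?case unfolding b by blast
  qed
qed

end
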